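(* Let $b\ge 2$ and let $A=R/I$ be a local ring of type $(2,b)$, where $R=K[[x,y,z]]$ and $I=(f,g)$ is generated by a regular sequence $f,g$ with $\operatorname{order}(f)=2$, $\operatorname{order}(g)=b$ and $g^*\notin (f^* )$. Then: (i) $HF_A(j)=2j+1$ if $0\le j<b$; (ii) $HF_A(b)=2b$; (iii) $HF_A(j-1)\le HF_A(j)\le HF_A(j-1)+1$ for all $j\ge b$; (iv) $HF_A$ admits at most $b-1$ flats.
   Context: $K$ is an algebraically closed field of characteristic zero, $R=K[[x,y,z]]$ with maximal ideal $\mathcal M=(x,y,z)$, $P=K[x,y,z]$. For nonzero $f\in R$, $\operatorname{order}(f)$ is the least degree $v$ of a monomial appearing in $f$, and $f^*\in P$ is the homogeneous component of degree $v$ of $f$ (its initial form); $(f^* )$ is an ideal of $P$. An ideal $I\subset R$ (or $A=R/I$) is of type $(a,b)$, $2\le a\le b$, if $I$ is generated by a regular sequence $\{f,g\}$ with $\operatorname{order}(f)=a$, $\operatorname{order}(g)=b$, $g^*\notin(f^* )$. For $A=R/I$ with maximal ideal $\mathfrak m=\mathcal M/I$, $HF_A(t)=\dim_K(\mathfrak m^t/\mathfrak m^{t+1})$. Such $A$ is a one-dimensional Cohen-Macaulay local ring; its multiplicity $e$ is the value of $HF_A(t)$ for all large $t$. $HF_A$ admits a flat in position $n$ if $HF_A(n)=HF_A(n+1)<e$. *)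

theory Defs
  imports
    "HOL-Algebra.QuotRing"
    "HOL-Algebra.Ideal_Product"
    "HOL-Algebra.Embedded_Algebras"
    "HOL-Algebra.Algebraic_Closure_Type"
    "HOL-Computational_Algebra.Formal_Power_Series"
begin

section \<open>Power series and polynomials in three variables\<close>

text \<open>
  \<open>K[[x,y,z]]\<close> is represented as \<open>K[[x]][[y]][[z]]\<close>, and \<open>K[x,y,z]\<close> as \<open>K[x][y][z]\<close>;
  the outermost variable is \<open>z\<close>.
\<close>

type_synonym 'k ps3 = "'k fps fps fps"
type_synonym 'k poly3 = "'k poly poly poly"

definition ps_ring :: "'k::comm_ring_1 ps3 ring" where
  "ps_ring = ring_of_type_algebra"

definition poly_ring :: "'k::comm_ring_1 poly3 ring" where
  "poly_ring = ring_of_type_algebra"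

definition ps_const :: "'k::comm_ring_1 \<Rightarrow> 'k ps3" where
  "ps_const c = fps_const (fps_const (fps_const c))"

definition ps_x :: "'k::comm_ring_1 ps3" where "ps_x = fps_const (fps_const fps_X)"
definition ps_y :: "'k::comm_ring_1 ps3" where "ps_y = fps_const fps_X"
definition ps_z :: "'k::comm_ring_1 ps3" where "ps_z = fps_X"

definition ps_coeff :: "'k::comm_ring_1 ps3 \<Rightarrow> nat \<Rightarrow> nat \<Rightarrow> nat \<Rightarrow> 'k" where
  "ps_coeff f i j k = fps_nth (fps_nth (fps_nth f k) j) i"

definition poly3_monom :: "'k::comm_ring_1 \<Rightarrow> nat \<Rightarrow> nat \<Rightarrow> nat \<Rightarrow> 'k poly3" where
  "poly3_monom c i j k = Polynomial.monom (Polynomial.monom (Polynomial.monom c i) j) k"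

text \<open>Order and initial form are only meaningful for nonzero power series.\<close>

definition ps_order :: "'k::comm_ring_1 ps3 \<Rightarrow> nat" where
  "ps_order f = (LEAST v. \<exists>i j k. i + j + k = v \<and> ps_coeff f i j k \<noteq> 0)"

definition initial_form :: "'k::comm_ring_1 ps3 \<Rightarrow> 'k poly3" where
  "initial_form f =
     (\<Sum>(i, j, k) \<in> {(i, j, k). i + j + k = ps_order f}. poly3_monom (ps_coeff f i j k) i j k)"

definition ps_max_ideal :: "'k::comm_ring_1 ps3 set" where
  "ps_max_ideal = Idl\<^bsub>ps_ring\<^esub> {ps_x, ps_y, ps_z}"


section \<open>Regular sequences and ideals of type \<open>(a,b)\<close>\<close>

text \<open>
  The implication says that \<open>fs ! i\<close> is a nonzerodivisor modulo the ideal generated by its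
  predecessors.
\<close>

definition regular_sequence :: "('a, 'm) ring_scheme \<Rightarrow> 'a list \<Rightarrow> bool" where
  "regular_sequence R fs \<longleftrightarrow>
     set fs \<subseteq> carrier R \<and>
     Idl\<^bsub>R\<^esub> (set fs) \<noteq> carrier R \<and>
     (\<forall>i < length fs. \<forall>h \<in> carrier R.
        fs ! i \<otimes>\<^bsub>R\<^esub> h \<in> Idl\<^bsub>R\<^esub> (set (take i fs)) \<longrightarrow> h \<in> Idl\<^bsub>R\<^esub> (set (take i fs)))"

definition ideal_of_type :: "nat \<Rightarrow> nat \<Rightarrow> 'k::comm_ring_1 ps3 set \<Rightarrow> bool" where
  "ideal_of_type a b I \<longleftrightarrow>
     2 \<le> a \<and> a \<le> b \<and>
     (\<exists>f g. I = Idl\<^bsub>ps_ring\<^esub> {f, g} \<and>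
        regular_sequence ps_ring [f, g] \<and>
        f \<noteq> 0 \<and> g \<noteq> 0 \<and>
        ps_order f = a \<and> ps_order g = b \<and>
        initial_form g \<notin> Idl\<^bsub>poly_ring\<^esub> {initial_form f})"


section \<open>Hilbert functions\<close>

text \<open>
  For a ring \<open>A\<close>, a subfield \<open>F\<close> of \<open>A\<close> and an ideal \<open>\<mm>\<close>, the value is the \<open>F\<close>-dimension of
  \<open>\<mm>\<^sup>t/\<mm>\<^sup>t\<^sup>+\<^sup>1\<close>. This quotient is the image of \<open>\<mm>\<^sup>t\<close> in the \<open>F\<close>-algebra \<open>A/\<mm>\<^sup>t\<^sup>+\<^sup>1\<close>, and
  its dimension is taken there, over the image of \<open>F\<close>.
\<close>

definition hilbert_function :: "('a, 'm) ring_scheme \<Rightarrow> 'a set \<Rightarrow> 'a set \<Rightarrow> nat \<Rightarrow> nat" where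
  "hilbert_function A F \<mm> t =
     (let J = \<mm> [^]\<^bsub>ideals_set A\<^esub> Suc t;
          \<pi> = (\<lambda>x. J +>\<^bsub>A\<^esub> x)
      in ring.dim (A Quot J) (\<pi> ` F) (\<pi> ` (\<mm> [^]\<^bsub>ideals_set A\<^esub> t)))"

definition HF :: "'k::field ps3 set \<Rightarrow> nat \<Rightarrow> nat" where
  "HF I =
     (let \<pi> = (\<lambda>x. I +>\<^bsub>ps_ring\<^esub> x)
      in hilbert_function (ps_ring Quot I) (\<pi> ` range ps_const) (\<pi> ` ps_max_ideal))"

text \<open>
  The multiplicity is read off a Hilbert function that is eventually constant, as it is for a
  one-dimensional local ring; the description is unspecified for other functions.
\<close>

definition hf_multiplicity :: "(nat \<Rightarrow> nat) \<Rightarrow> nat" where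
  "hf_multiplicity H = (THE e. \<exists>N. \<forall>t \<ge> N. H t = e)"

definition flat_at :: "(nat \<Rightarrow> nat) \<Rightarrow> nat \<Rightarrow> bool" where
  "flat_at H n \<longleftrightarrow> H n = H (n + 1) \<and> H n < hf_multiplicity H"

end

theory Submission
  imports Defs "HOL-Library.Product_Lexorder" "HOL-Library.Product_Plus"
begin

text \<open>
  After a linear change of coordinates \<open>f\<close> contains \<open>x\<^sup>2\<close>, so by division every class modulo \<open>f\<close> has
  a unique representative without multiples of \<open>x\<^sup>2\<close>, and passing to it never cancels leading terms.
  Hence \<open>HF(n) = 2n + 1 - a\<^sub>n\<close>, where \<open>a\<^sub>n\<close> counts the leading exponents of degree \<open>n\<close> of the reduced
  elements of \<open>I\<close>. There are none below degree \<open>b\<close> and exactly one in degree \<open>b\<close>.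

  From degree \<open>b\<close> on \<open>a\<^sub>n\<close> grows by at least one in each step, because multiplying by \<open>y\<close> an element of
  least \<open>z\<close>-exponent gives something outside the \<open>z\<close>-multiples. It grows by at most two, because
  modulo \<open>(f, z)\<close> the ideal is cyclic over a ring of rank two over the discrete valuation ring \<open>K[[y]]\<close>:
  among any three reduced elements of order \<open>n + 1\<close> there is a relation over \<open>K[[y]]\<close> with a unit
  coefficient, whose left-hand side is \<open>z\<close> times an element of the ideal. If \<open>HF(n) \<le> n\<close>, or if two
  exponents of degree \<open>n\<close> share their \<open>z\<close>-exponent, then \<open>a\<^sub>n\<close> grows by exactly two. The latter happens
  for all large \<open>n\<close>, since \<open>I\<close> contains a nonzero series in \<open>y, z\<close> alone. So a flat in position \<open>n\<close> has
  \<open>n < HF(n) < e\<close>, and if \<open>M\<close> is the last flat, then \<open>M + 2 \<le> HF(M + 1) = b + M + 1 - #flats\<close>.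
\<close>

section \<open>Exponents and leading terms\<close>

declare split_paired_All [simp del] split_paired_Ex [simp del]

type_synonym expo = "nat \<times> nat \<times> nat"

definition cf :: "'k::comm_ring_1 ps3 \<Rightarrow> expo \<Rightarrow> 'k" where
  "cf f = (\<lambda>(i, j, k). ps_coeff f i j k)"

text \<open>Leading terms have least key: lowest degree first, then highest power of \<open>x\<close>, then of \<open>y\<close>.\<close>

definition lead_key :: "expo \<Rightarrow> nat \<times> nat \<times> nat" where
  "lead_key = (\<lambda>(a, b, c). (a + b + c, b + c, c))"

definition tdeg :: "expo \<Rightarrow> nat" where
  "tdeg = (\<lambda>(a, b, c). a + b + c)"

lemma cf_triple: "cf f (a, b, c) = fps_nth (fps_nth (fps_nth f c) b) a"
  by (simp add: cf_def ps_coeff_def)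

lemma tdeg_triple [simp]: "tdeg (a, b, c) = a + b + c"
  by (simp add: tdeg_def)

lemma lead_key_triple [simp]: "lead_key (a, b, c) = (a + b + c, b + c, c)"
  by (simp add: lead_key_def)

lemma tdeg_add: "tdeg (m + n) = tdeg m + tdeg n"
  by (cases m; cases n) simp

lemma lead_key_add: "lead_key (m + n) = lead_key m + lead_key n"
  by (cases m; cases n) simp

lemma lead_key_inj: "lead_key m = lead_key n \<Longrightarrow> m = n"
  by (cases m; cases n) auto

lemma lead_key_deg_less: "tdeg m < tdeg n \<Longrightarrow> lead_key m < lead_key n"
  by (cases m; cases n) simp

lemma lead_key_less_deg: "lead_key m < lead_key n \<Longrightarrow> tdeg m \<le> tdeg n"
  by (cases m; cases n) auto

lemma lex_add_strict_mono: "(p::expo) < q \<Longrightarrow> p + r < q + r"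
  by (cases p; cases q; cases r) auto

lemma lead_key_add_less: "lead_key m < lead_key n \<Longrightarrow> lead_key (m + p) < lead_key (n + p)"
  by (simp add: lead_key_add lex_add_strict_mono)

lemma expo_add_cancel: "(p::expo) + q = p + r \<longleftrightarrow> q = r"
  by (cases p; cases q; cases r) auto

lemma expo_add_commute: "(p::expo) + q = q + p"
  by (cases p; cases q) auto

lemma cf_0 [simp]: "cf 0 m = 0"
  by (cases m) (simp add: cf_triple)

lemma cf_add [simp]: "cf (f + g) m = cf f m + cf g m"
  by (cases m) (simp add: cf_triple)

lemma cf_diff [simp]: "cf (f - g) m = cf f m - cf g m"
  by (cases m) (simp add: cf_triple)

lemma cf_uminus [simp]: "cf (- f) m = - cf f m"
  by (cases m) (simp add: cf_triple)

lemma cf_sum: "cf (sum F A) m = (\<Sum>x\<in>A. cf (F x) m)"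
  by (induction A rule: infinite_finite_induct) auto

lemma cf_eqI: "(\<And>m. cf f m = cf g m) \<Longrightarrow> f = g"
proof -
  assume h: "\<And>m. cf f m = cf g m"
  have "fps_nth (fps_nth (fps_nth f c) b) a = fps_nth (fps_nth (fps_nth g c) b) a" for a b c
    using h[of "(a, b, c)"] by (simp add: cf_triple)
  then show "f = g" by (intro fps_ext)
qed

lemma cf_nonzero: "f \<noteq> 0 \<Longrightarrow> \<exists>m. cf f m \<noteq> 0"
  using cf_eqI[of f 0] by auto

lemma finite_decomp: "finite {(p, q). p + q = (m::expo)}"
proof -
  obtain a b c where m: "m = (a, b, c)" by (cases m)
  have "{(p, q). p + q = m} \<subseteq> ({..a} \<times> {..b} \<times> {..c}) \<times> ({..a} \<times> {..b} \<times> {..c})"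
    by (auto simp: m)
  then show ?thesis by (rule finite_subset) auto
qed

lemma cf_mult: "cf (f * g) m = (\<Sum>(p, q)\<in>{(p, q). p + q = m}. cf f p * cf g q)"
proof -
  obtain a b c where m: "m = (a, b, c)" by (cases m)
  have "cf (f * g) m = (\<Sum>k=0..c. \<Sum>j=0..b. \<Sum>i=0..a. cf f (i, j, k) * cf g (a - i, b - j, c - k))"
    by (simp add: m cf_triple fps_mult_nth fps_sum_nth)
  also have "\<dots> = (\<Sum>(k, j, i)\<in>{0..c} \<times> {0..b} \<times> {0..a}. cf f (i, j, k) * cf g (a - i, b - j, c - k))"
    by (simp add: sum.cartesian_product)
  also have "\<dots> = (\<Sum>(p, q)\<in>{(p, q). p + q = m}. cf f p * cf g q)"
    by (rule sum.reindex_bij_witness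
        [of _ "\<lambda>((i, j, k), q). (k, j, i)" "\<lambda>(k, j, i). ((i, j, k), (a - i, b - j, c - k))"])
      (auto simp: m)
  finally show ?thesis .
qed

lemma cf_const: "cf (ps_const c) m = (if m = (0, 0, 0) then c else 0)"
  by (cases m) (auto simp: cf_triple ps_const_def)

lemma cf_const_mult [simp]: "cf (ps_const c * f) m = c * cf f m"
  by (cases m) (auto simp: cf_triple ps_const_def)

lemma cf_x_mult: "cf (ps_x * f) (a, b, c) = (if a = 0 then 0 else cf f (a - 1, b, c))"
  by (auto simp: cf_triple ps_x_def)

lemma cf_y_mult: "cf (ps_y * f) (a, b, c) = (if b = 0 then 0 else cf f (a, b - 1, c))"
  by (auto simp: cf_triple ps_y_def)

lemma cf_z_mult: "cf (ps_z * f) (a, b, c) = (if c = 0 then 0 else cf f (a, b, c - 1))"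
  by (auto simp: cf_triple ps_z_def)

lemma ps_const_simps:
  "ps_const 0 = 0" "ps_const 1 = 1"
  "ps_const (c + d) = ps_const c + ps_const d"
  "ps_const (c * d) = ps_const c * ps_const d"
  "ps_const (- c) = - ps_const c"
  by (simp_all add: ps_const_def)

definition ps_monom :: "expo \<Rightarrow> 'k::comm_ring_1 ps3" where
  "ps_monom = (\<lambda>(a, b, c). ps_x ^ a * ps_y ^ b * ps_z ^ c)"

lemma cf_x_pow_mult: "cf (ps_x ^ n * f) (a, b, c) = (if a < n then 0 else cf f (a - n, b, c))"
  by (induction n arbitrary: a) (auto simp: cf_x_mult mult.assoc)

lemma cf_y_pow_mult: "cf (ps_y ^ n * f) (a, b, c) = (if b < n then 0 else cf f (a, b - n, c))"
  by (induction n arbitrary: b) (auto simp: cf_y_mult mult.assoc)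

lemma cf_z_pow_mult: "cf (ps_z ^ n * f) (a, b, c) = (if c < n then 0 else cf f (a, b, c - n))"
  by (induction n arbitrary: c) (auto simp: cf_z_mult mult.assoc)

lemma cf_monom: "cf (ps_monom p) m = (if m = p then 1 else 0)"
proof -
  obtain a b c a' b' c' where p: "p = (a, b, c)" and m: "m = (a', b', c')" by (metis surj_pair)
  have one: "cf 1 q = (if q = (0, 0, 0) then 1 else 0)" for q
    using cf_const[of 1 q] by (simp add: ps_const_simps)
  have "cf (ps_x ^ a * (ps_y ^ b * (ps_z ^ c * 1))) m = (if m = p then 1 else 0)"
    unfolding p m cf_x_pow_mult cf_y_pow_mult cf_z_pow_mult one by auto
  then show ?thesis by (simp add: p ps_monom_def mult.assoc)
qed

section \<open>Leading exponents and their behaviour under products and sums\<close>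

definition is_lead :: "'k::comm_ring_1 ps3 \<Rightarrow> expo \<Rightarrow> bool" where
  "is_lead f m \<longleftrightarrow> cf f m \<noteq> 0 \<and> (\<forall>m'. lead_key m' < lead_key m \<longrightarrow> cf f m' = 0)"

text \<open>The lexicographic order on triples of naturals is a well-order, so the keys of the
  support have a least element.\<close>

lemma is_lead_ex: "f \<noteq> 0 \<Longrightarrow> \<exists>m. is_lead f m"
proof -
  assume "f \<noteq> 0"
  then obtain m0 where m0: "cf f m0 \<noteq> 0" using cf_nonzero by blast
  define P where "P = (\<lambda>k. \<exists>m. lead_key m = k \<and> cf f m \<noteq> 0)"
  have "P (LEAST k. P k)" by (rule LeastI[of P "lead_key m0"]) (use m0 in \<open>auto simp: P_def\<close>)
  then obtain m where m: "lead_key m = (LEAST k. P k)" "cf f m \<noteq> 0" by (auto simp: P_def)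
  have "cf f m' = 0" if "lead_key m' < lead_key m" for m'
    using not_less_Least[of "lead_key m'" P] that m(1) by (auto simp: P_def)
  with m show ?thesis by (auto simp: is_lead_def)
qed

lemma is_lead_unique: "is_lead f m \<Longrightarrow> is_lead f n \<Longrightarrow> m = n"
  by (metis is_lead_def lead_key_inj linorder_less_linear)

lemma is_lead_nonzero: "is_lead f m \<Longrightarrow> f \<noteq> 0"
  by (auto simp: is_lead_def)

text \<open>The key order is strictly compatible with addition. A decomposition \<open>p + q\<close>
  with key at most that of \<open>m + n\<close> and different from \<open>(m, n)\<close> therefore
  has \<open>p\<close> before \<open>m\<close> or \<open>q\<close> before \<open>n\<close>, and
  contributes zero. The single remaining product is nonzero in a domain.\<close>

lemma is_lead_mult:
  fixes f g :: "'k::idom ps3"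
  assumes "is_lead f m" "is_lead g n"
  shows "is_lead (f * g) (m + n)"
  unfolding is_lead_def
proof (intro conjI allI impI)
  have z: "cf f p * cf g q = 0" if "lead_key (p + q) \<le> lead_key (m + n)" "(p, q) \<noteq> (m, n)" for p q
  proof (cases "lead_key p < lead_key m \<or> lead_key q < lead_key n")
    case True
    with assms show ?thesis by (auto simp: is_lead_def)
  next
    case False
    then have le: "lead_key m \<le> lead_key p" "lead_key n \<le> lead_key q" by auto
    have "lead_key m \<noteq> lead_key p \<or> lead_key n \<noteq> lead_key q" using that(2) lead_key_inj by blast
    then have "lead_key (m + n) < lead_key (p + q)"
    proof
      assume "lead_key m \<noteq> lead_key p"
      with le have "lead_key (m + n) < lead_key (p + n)" by (intro lead_key_add_less) simp
      also have "lead_key (p + n) \<le> lead_key (p + q)"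
        using le(2) lead_key_add_less[of n q p] lead_key_inj[of n q]
        by (metis expo_add_commute order_le_less)
      finally show ?thesis .
    next
      assume "lead_key n \<noteq> lead_key q"
      with le have "lead_key (n + p) < lead_key (q + p)" by (intro lead_key_add_less) simp
      moreover have "lead_key (m + n) \<le> lead_key (p + n)"
        using le(1) lead_key_add_less[of m p n] lead_key_inj[of m p]
        by (metis order_le_less)
      ultimately show ?thesis by (metis expo_add_commute order_le_less_trans)
    qed
    with that(1) show ?thesis by simp
  qed
  have "cf (f * g) (m + n) = (\<Sum>(p, q)\<in>{(m, n)}. cf f p * cf g q)"
    unfolding cf_mult
  proof (rule sum.mono_neutral_right[OF finite_decomp])
    show "\<forall>i\<in>{(p, q). p + q = m + n} - {(m, n)}. (case i of (p, q) \<Rightarrow> cf f p * cf g q) = 0"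
    proof
      fix i assume i: "i \<in> {(p, q). p + q = m + n} - {(m, n)}"
      obtain p q where "i = (p, q)" by (cases i)
      with i z[of p q] show "(case i of (p, q) \<Rightarrow> cf f p * cf g q) = 0" by auto
    qed
  qed auto
  then show "cf (f * g) (m + n) \<noteq> 0" using assms by (auto simp: is_lead_def)
  fix m' assume less: "lead_key m' < lead_key (m + n)"
  show "cf (f * g) m' = 0"
    unfolding cf_mult
  proof (rule sum.neutral, rule ballI)
    fix i assume i: "i \<in> {(p, q). p + q = m'}"
    obtain p q where "i = (p, q)" by (cases i)
    with i less z[of p q] show "(case i of (p, q) \<Rightarrow> cf f p * cf g q) = 0" by fastforce
  qed
qed

lemma is_lead_add_less:
  assumes "is_lead f m" "\<And>m'. lead_key m' \<le> lead_key m \<Longrightarrow> cf g m' = 0"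
  shows "is_lead (f + g) m"
  using assms by (auto simp: is_lead_def)

lemma is_lead_add:
  assumes "is_lead f m" "is_lead g n" "lead_key m < lead_key n"
  shows "is_lead (f + g) m"
  using assms by (intro is_lead_add_less) (auto simp: is_lead_def)

lemma is_lead_monom_mult:
  fixes f :: "'k::idom ps3"
  shows "is_lead f m \<Longrightarrow> is_lead (ps_monom p * f) (p + m)"
  by (rule is_lead_mult) (auto simp: is_lead_def cf_monom)

text \<open>This is the \<open>n\<close>-th power of the maximal ideal, described by vanishing
  coefficients so that membership can be checked exponent by exponent.\<close>

definition ps_ge :: "nat \<Rightarrow> 'k::comm_ring_1 ps3 set" where
  "ps_ge n = {f. \<forall>m. tdeg m < n \<longrightarrow> cf f m = 0}"

lemma ps_ge_0 [simp]: "ps_ge 0 = UNIV"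
  by (simp add: ps_ge_def)

lemma ps_geI: "(\<And>m. tdeg m < n \<Longrightarrow> cf f m = 0) \<Longrightarrow> f \<in> ps_ge n"
  by (simp add: ps_ge_def)

lemma ps_geD: "f \<in> ps_ge n \<Longrightarrow> tdeg m < n \<Longrightarrow> cf f m = 0"
  by (simp add: ps_ge_def)

lemma ps_ge_zero [simp]: "0 \<in> ps_ge n"
  by (simp add: ps_ge_def)

lemma ps_ge_add: "f \<in> ps_ge n \<Longrightarrow> g \<in> ps_ge n \<Longrightarrow> f + g \<in> ps_ge n"
  by (simp add: ps_ge_def)

lemma ps_ge_diff: "f \<in> ps_ge n \<Longrightarrow> g \<in> ps_ge n \<Longrightarrow> f - g \<in> ps_ge n"
  by (simp add: ps_ge_def)

lemma ps_ge_sum: "(\<And>x. x \<in> A \<Longrightarrow> F x \<in> ps_ge n) \<Longrightarrow> sum F A \<in> ps_ge n"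
  by (simp add: ps_ge_def cf_sum)

lemma ps_ge_mono: "f \<in> ps_ge n \<Longrightarrow> m \<le> n \<Longrightarrow> f \<in> ps_ge m"
  by (auto simp: ps_ge_def)

lemma ps_ge_mult:
  assumes "f \<in> ps_ge m" "g \<in> ps_ge n"
  shows "f * g \<in> ps_ge (m + n)"
proof (rule ps_geI)
  fix r assume r: "tdeg r < m + n"
  have "cf f p * cf g q = 0" if "p + q = r" for p q
  proof -
    have "tdeg p + tdeg q = tdeg r" using that tdeg_add by metis
    then have "tdeg p < m \<or> tdeg q < n" using r by linarith
    then show ?thesis using assms by (auto dest: ps_geD)
  qed
  then show "cf (f * g) r = 0" unfolding cf_mult by (intro sum.neutral) auto
qed

lemma ps_ge_mult_left: "g \<in> ps_ge n \<Longrightarrow> f * g \<in> ps_ge n"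
  using ps_ge_mult[of f 0 g n] by simp

lemma ps_ge_mult_right: "f \<in> ps_ge n \<Longrightarrow> f * g \<in> ps_ge n"
  using ps_ge_mult[of f n g 0] by simp

lemma ps_ge_monom: "ps_monom p \<in> ps_ge (tdeg p)"
  by (auto simp: ps_ge_def cf_monom)

text \<open>The degree is the first component of the key, so a leading exponent has the least degree
  in the support.\<close>

lemma is_lead_ge_iff:
  assumes "is_lead f m"
  shows "f \<in> ps_ge n \<longleftrightarrow> n \<le> tdeg m"
proof
  show "f \<in> ps_ge n \<Longrightarrow> n \<le> tdeg m"
    using assms by (metis is_lead_def not_le ps_geD)
  assume "n \<le> tdeg m"
  then show "f \<in> ps_ge n"
    using assms lead_key_deg_less by (fastforce simp: ps_ge_def is_lead_def)
qed

lemma ps_eq_0_if_ge: "(\<And>n. f \<in> ps_ge n) \<Longrightarrow> f = 0"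
  using is_lead_ex is_lead_ge_iff by (metis not_less_eq_eq)

text \<open>Orders add because leading exponents do, and the second assumption says that
  \<open>g\<close> has order at most \<open>d\<close>.\<close>

lemma ps_ge_mult_cancel:
  fixes f g :: "'k::idom ps3"
  assumes "f * g \<in> ps_ge (n + d)" "g \<notin> ps_ge (Suc d)"
  shows "f \<in> ps_ge n"
proof (cases "f = 0")
  case False
  then obtain m where m: "is_lead f m" using is_lead_ex by blast
  have "g \<noteq> 0" using assms(2) by auto
  then obtain p where p: "is_lead g p" using is_lead_ex by blast
  have "n + d \<le> tdeg m + tdeg p"
    using assms(1) is_lead_ge_iff[OF is_lead_mult[OF m p]] by (simp add: tdeg_add)
  moreover have "tdeg p \<le> d" using is_lead_ge_iff[OF p] assms(2) by auto
  ultimately show ?thesis using is_lead_ge_iff[OF m] by auto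
qed simp

lemma ps_ge_1_iff: "f \<in> ps_ge 1 \<longleftrightarrow> cf f (0, 0, 0) = 0"
  by (auto simp: ps_ge_def)

text \<open>Both constant terms vanish, so only the product of the two linear terms reaches
  \<open>x^2\<close>. This evaluates a quadratic form after a change of coordinates.\<close>

lemma cf_1_mult_1:
  assumes "f \<in> ps_ge 1" "g \<in> ps_ge 1"
  shows "cf (f * g) (2, 0, 0) = cf f (1, 0, 0) * cf g (1, 0, 0)"
proof -
  have D: "{(p, q). p + q = ((2, 0, 0) :: expo)} = {((0, 0, 0), (2, 0, 0)), ((1, 0, 0), (1, 0, 0)), ((2, 0, 0), (0, 0, 0))}"
    (is "?A = ?B")
  proof (rule Set.set_eqI)
    fix t :: "expo \<times> expo"
    obtain a b c a' b' c' where t: "t = ((a, b, c), (a', b', c'))" by (metis surj_pair)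
    have e: "a + a' = 2 \<longleftrightarrow> a = 0 \<and> a' = 2 \<or> a = 1 \<and> a' = 1 \<or> a = 2 \<and> a' = 0" by arith
    show "t \<in> ?A \<longleftrightarrow> t \<in> ?B" unfolding t by (simp add: e) blast
  qed
  have "cf f (0, 0, 0) = 0" "cf g (0, 0, 0) = 0" using assms ps_ge_1_iff by blast+
  then show ?thesis unfolding cf_mult D by simp
qed

section \<open>Linear substitutions\<close>

lemma ps_eqI_ge:
  assumes "\<And>n. f - g \<in> ps_ge (Suc n)"
  shows "f = g"
proof -
  have "f - g \<in> ps_ge n" for n using assms[of n] by (rule ps_ge_mono) simp
  then have "f - g = 0" by (rule ps_eq_0_if_ge)
  then show ?thesis by simp
qed

lemma cf_1: "cf 1 m = (if m = (0, 0, 0) then 1 else 0)"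
  using cf_const[of 1 m] by (simp add: ps_const_simps)

definition ps_of_cf :: "(expo \<Rightarrow> 'k) \<Rightarrow> 'k::comm_ring_1 ps3" where
  "ps_of_cf h = Abs_fps (\<lambda>c. Abs_fps (\<lambda>b. Abs_fps (\<lambda>a. h (a, b, c))))"

lemma cf_ps_of_cf [simp]: "cf (ps_of_cf h) m = h m"
  by (cases m) (simp add: cf_triple ps_of_cf_def)

lemma finite_tdeg_le: "finite {p. tdeg p \<le> n}"
proof -
  have "{p. tdeg p \<le> n} \<subseteq> {..n} \<times> {..n} \<times> {..n}"
  proof
    fix p assume "p \<in> {p. tdeg p \<le> n}"
    then show "p \<in> {..n} \<times> {..n} \<times> {..n}" by (cases p) auto
  qed
  then show ?thesis by (rule finite_subset) auto
qed

lemma finite_tdeg_eq: "finite {p. tdeg p = n}"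
  by (rule finite_subset[OF _ finite_tdeg_le[of n]]) auto

text \<open>Density of polynomials in the adic topology: statements about substitutions reduce to
  finite sums of monomials.\<close>

lemma ps_approx:
  "f - (\<Sum>p | tdeg p \<le> n. ps_const (cf f p) * ps_monom p) \<in> ps_ge (Suc n)"
proof (rule ps_geI)
  fix m assume "tdeg m < Suc n"
  then show "cf (f - (\<Sum>p | tdeg p \<le> n. ps_const (cf f p) * ps_monom p)) m = 0"
    by (simp add: cf_sum cf_monom finite_tdeg_le if_distrib cong: if_cong)
qed

text \<open>The last clause is a continuity condition. It makes such a \<open>K\<close>-algebra
  endomorphism determined by the images of the three variables.\<close>

definition ps_endo :: "('k::comm_ring_1 ps3 \<Rightarrow> 'k ps3) \<Rightarrow> bool" where
  "ps_endo \<phi> \<longleftrightarrow> (\<forall>f g. \<phi> (f + g) = \<phi> f + \<phi> g) \<and> (\<forall>f g. \<phi> (f * g) = \<phi> f * \<phi> g) \<and>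
     (\<forall>c. \<phi> (ps_const c) = ps_const c) \<and> (\<forall>n f. f \<in> ps_ge n \<longrightarrow> \<phi> f \<in> ps_ge n)"

lemma ps_endoD:
  assumes "ps_endo \<phi>"
  shows "\<phi> (f + g) = \<phi> f + \<phi> g" "\<phi> (f * g) = \<phi> f * \<phi> g" "\<phi> (ps_const c) = ps_const c"
    "f \<in> ps_ge n \<Longrightarrow> \<phi> f \<in> ps_ge n"
  using assms by (auto simp: ps_endo_def)

lemma ps_endo_simps:
  assumes "ps_endo \<phi>"
  shows "\<phi> 0 = 0" "\<phi> 1 = 1" "\<phi> (- f) = - \<phi> f" "\<phi> (f - g) = \<phi> f - \<phi> g" "\<phi> (f ^ n) = \<phi> f ^ n"
    "\<phi> (sum F A) = (\<Sum>x\<in>A. \<phi> (F x))"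
proof -
  show z: "\<phi> 0 = 0" and o: "\<phi> 1 = 1"
    using ps_endoD(3)[OF assms, of 0] ps_endoD(3)[OF assms, of 1] by (simp_all add: ps_const_simps)
  show m: "\<phi> (- f) = - \<phi> f" for f
    using ps_endoD(1)[OF assms, of f "- f"] by (simp add: z eq_neg_iff_add_eq_0 add.commute)
  show "\<phi> (f - g) = \<phi> f - \<phi> g"
    using ps_endoD(1)[OF assms, of f "- g"] by (simp add: m)
  show "\<phi> (f ^ n) = \<phi> f ^ n"
    by (induction n) (simp_all add: o ps_endoD(2)[OF assms])
  show "\<phi> (sum F A) = (\<Sum>x\<in>A. \<phi> (F x))"
    by (induction A rule: infinite_finite_induct) (simp_all add: z ps_endoD(1)[OF assms])
qed

lemma ps_endo_monom:
  assumes "ps_endo \<phi>"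
  shows "\<phi> (ps_monom (a, b, c)) = \<phi> ps_x ^ a * \<phi> ps_y ^ b * \<phi> ps_z ^ c"
  by (simp add: ps_monom_def ps_endoD(2)[OF assms] ps_endo_simps(5)[OF assms])

lemma ps_endo_compose: "ps_endo \<phi> \<Longrightarrow> ps_endo \<psi> \<Longrightarrow> ps_endo (\<lambda>f. \<psi> (\<phi> f))"
  by (simp add: ps_endo_def)

text \<open>\<open>\<phi>\<close> fixes every polynomial. Replacing \<open>f\<close> by its
  truncation changes \<open>\<phi> f - f\<close> only by terms of arbitrarily high order.\<close>

lemma ps_endo_eq_id:
  assumes "ps_endo \<phi>" "\<phi> ps_x = ps_x" "\<phi> ps_y = ps_y" "\<phi> ps_z = ps_z"
  shows "\<phi> f = f"
proof -
  have "\<phi> f - f \<in> ps_ge (Suc n)" for n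
  proof -
    define t where "t = (\<Sum>p | tdeg p \<le> n. ps_const (cf f p) * ps_monom p)"
    have mono: "\<phi> (ps_monom p) = ps_monom p" for p
      by (cases p) (simp only: ps_endo_monom[OF assms(1)] assms(2-4), simp add: ps_monom_def)
    have t: "\<phi> t = t"
      by (simp add: t_def ps_endo_simps(6)[OF assms(1)] ps_endoD[OF assms(1)] mono)
    have ft: "f - t \<in> ps_ge (Suc n)" unfolding t_def by (rule ps_approx)
    have "\<phi> (f - t) - (f - t) \<in> ps_ge (Suc n)"
      by (rule ps_ge_diff[OF ps_endoD(4)[OF assms(1) ft] ft])
    then show ?thesis by (simp add: ps_endo_simps(4)[OF assms(1)] t)
  qed
  then show ?thesis by (rule ps_eqI_ge)
qed

section \<open>Substitution of power series without constant term\<close>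

definition subst_monom :: "'k::comm_ring_1 ps3 \<Rightarrow> 'k ps3 \<Rightarrow> 'k ps3 \<Rightarrow> expo \<Rightarrow> 'k ps3" where
  "subst_monom u v w = (\<lambda>(a, b, c). u ^ a * v ^ b * w ^ c)"

definition psubst_trunc :: "'k::comm_ring_1 ps3 \<Rightarrow> 'k ps3 \<Rightarrow> 'k ps3 \<Rightarrow> nat \<Rightarrow> 'k ps3 \<Rightarrow> 'k ps3" where
  "psubst_trunc u v w n f = (\<Sum>p | tdeg p \<le> n. ps_const (cf f p) * subst_monom u v w p)"

text \<open>The infinite sum is defined coefficientwise: at \<open>m\<close> only monomials of
  degree at most \<open>tdeg m\<close> can contribute once \<open>u\<close>, \<open>v\<close>,
  \<open>w\<close> have no constant term, so a truncation depending on \<open>m\<close>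
  suffices.\<close>

definition psubst :: "'k::comm_ring_1 ps3 \<Rightarrow> 'k ps3 \<Rightarrow> 'k ps3 \<Rightarrow> 'k ps3 \<Rightarrow> 'k ps3" where
  "psubst u v w f = ps_of_cf (\<lambda>m. cf (psubst_trunc u v w (tdeg m) f) m)"

lemma ps_ge_power: "u \<in> ps_ge 1 \<Longrightarrow> u ^ n \<in> ps_ge n"
proof (induction n)
  case (Suc n)
  then show ?case using ps_ge_mult[of u 1 "u ^ n" n] by simp
qed simp

lemma subst_monom_add: "subst_monom u v w (p + q) = subst_monom u v w p * subst_monom u v w q"
  by (cases p; cases q) (simp add: subst_monom_def power_add mult_ac)

context
  fixes u v w :: "'k::comm_ring_1 ps3"
  assumes uvw_ge: "u \<in> ps_ge 1" "v \<in> ps_ge 1" "w \<in> ps_ge 1"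
begin

lemma subst_monom_ge: "subst_monom u v w p \<in> ps_ge (tdeg p)"
  using uvw_ge by (cases p) (auto simp: subst_monom_def intro!: ps_ge_mult ps_ge_power)

lemma cf_subst_monom_eq_0: "tdeg m < tdeg p \<Longrightarrow> cf (subst_monom u v w p) m = 0"
  using subst_monom_ge ps_geD by blast

lemma cf_psubst:
  assumes "tdeg m \<le> n"
  shows "cf (psubst u v w f) m = cf (psubst_trunc u v w n f) m"
proof -
  have "cf (psubst_trunc u v w n f) m = (\<Sum>p | tdeg p \<le> n. cf f p * cf (subst_monom u v w p) m)"
    by (simp add: psubst_trunc_def cf_sum)
  also have "\<dots> = (\<Sum>p | tdeg p \<le> tdeg m. cf f p * cf (subst_monom u v w p) m)"
    using assms by (intro sum.mono_neutral_right finite_tdeg_le) (auto simp: cf_subst_monom_eq_0)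
  also have "\<dots> = cf (psubst u v w f) m"
    by (simp add: psubst_def psubst_trunc_def cf_sum)
  finally show ?thesis ..
qed

lemma psubst_trunc_ge: "f \<in> ps_ge k \<Longrightarrow> psubst_trunc u v w n f \<in> ps_ge k"
  unfolding psubst_trunc_def
proof (rule ps_ge_sum)
  fix p assume f: "f \<in> ps_ge k"
  show "ps_const (cf f p) * subst_monom u v w p \<in> ps_ge k"
  proof (cases "tdeg p < k")
    case True
    then show ?thesis using f by (simp add: ps_geD ps_const_simps)
  next
    case False
    then show ?thesis using ps_ge_mult_left[OF subst_monom_ge[of p]] ps_ge_mono by (metis not_less)
  qed
qed

text \<open>The product of two truncations runs over all pairs of exponents of degree at most
  \<open>n\<close>. Pairs of total degree above \<open>n\<close> are invisible up to degree
  \<open>n\<close>, and the others regroup by their sum into the Cauchy product.\<close>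

lemma psubst_trunc_mult:
  "psubst_trunc u v w n f * psubst_trunc u v w n g - psubst_trunc u v w n (f * g) \<in> ps_ge (Suc n)"
proof (rule ps_geI)
  fix m assume m: "tdeg m < Suc n"
  let ?L = "{p. tdeg p \<le> n}"
  let ?h = "\<lambda>p q. cf f p * cf g q * cf (subst_monom u v w (p + q)) m"
  have "cf (psubst_trunc u v w n f * psubst_trunc u v w n g) m =
      cf (\<Sum>p\<in>?L. \<Sum>q\<in>?L. ps_const (cf f p * cf g q) * subst_monom u v w (p + q)) m"
    unfolding psubst_trunc_def sum_product
    by (simp add: subst_monom_add ps_const_simps mult_ac)
  also have "\<dots> = (\<Sum>(p, q)\<in>?L \<times> ?L. ?h p q)"
    by (simp add: cf_sum sum.cartesian_product case_prod_beta)
  also have "\<dots> = (\<Sum>(p, q)\<in>{(p, q). tdeg (p + q) \<le> n}. ?h p q)"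
  proof (rule sum.mono_neutral_right)
    show "finite (?L \<times> ?L)" by (simp add: finite_tdeg_le)
    show "{(p, q). tdeg (p + q) \<le> n} \<subseteq> ?L \<times> ?L" by (clarify, simp add: tdeg_add)
    show "\<forall>i\<in>?L \<times> ?L - {(p, q). tdeg (p + q) \<le> n}. (case i of (p, q) \<Rightarrow> ?h p q) = 0"
    proof
      fix i assume i: "i \<in> ?L \<times> ?L - {(p, q). tdeg (p + q) \<le> n}"
      obtain p q where "i = (p, q)" by (cases i)
      with i m show "(case i of (p, q) \<Rightarrow> ?h p q) = 0" by (simp add: cf_subst_monom_eq_0)
    qed
  qed
  also have "\<dots> = (\<Sum>(r, (p, q))\<in>Sigma ?L (\<lambda>r. {(p, q). p + q = r}). ?h p q)"
    by (rule sum.reindex_bij_witness[of _ "\<lambda>(r, t). t" "\<lambda>(p, q). (p + q, (p, q))"]) auto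
  also have "\<dots> = (\<Sum>r\<in>?L. \<Sum>(p, q)\<in>{(p, q). p + q = r}. ?h p q)"
    by (rule sum.Sigma[symmetric]) (auto simp: finite_tdeg_le finite_decomp)
  also have "\<dots> = (\<Sum>r\<in>?L. cf (f * g) r * cf (subst_monom u v w r) m)"
    unfolding cf_mult sum_distrib_right
    by (intro sum.cong refl) (auto simp: case_prod_beta)
  also have "\<dots> = cf (psubst_trunc u v w n (f * g)) m"
    by (simp add: psubst_trunc_def cf_sum)
  finally show "cf (psubst_trunc u v w n f * psubst_trunc u v w n g - psubst_trunc u v w n (f * g)) m = 0"
    by simp
qed

lemma psubst_approx: "psubst u v w f - psubst_trunc u v w n f \<in> ps_ge (Suc n)"
  by (rule ps_geI) (simp add: cf_psubst[where n = n])

lemma psubst_mult: "psubst u v w (f * g) = psubst u v w f * psubst u v w g"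
proof -
  let ?\<phi> = "psubst u v w"
  have "?\<phi> f * ?\<phi> g - ?\<phi> (f * g) \<in> ps_ge (Suc n)" for n
  proof -
    let ?t = "psubst_trunc u v w n"
    \<comment> \<open>Telescoping: the two factors and the product are replaced by their truncations
      one at a time, each at the cost of an error of order above \<open>n\<close>.\<close>
    have "?\<phi> f * ?\<phi> g - ?\<phi> (f * g) = (?\<phi> f - ?t f) * ?\<phi> g + ?t f * (?\<phi> g - ?t g)
        + (?t f * ?t g - ?t (f * g)) - (?\<phi> (f * g) - ?t (f * g))"
      by (simp add: algebra_simps)
    also have "\<dots> \<in> ps_ge (Suc n)"
      by (intro ps_ge_diff ps_ge_add ps_ge_mult_left ps_ge_mult_right psubst_approx psubst_trunc_mult)
    finally show ?thesis .
  qed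
  then show ?thesis by (rule ps_eqI_ge[symmetric])
qed

lemma psubst_of_monom: "psubst u v w (ps_monom p) = subst_monom u v w p"
proof (rule cf_eqI)
  fix m
  let ?n = "tdeg m + tdeg p"
  have "cf (psubst u v w (ps_monom p)) m = cf (psubst_trunc u v w ?n (ps_monom p)) m"
    by (rule cf_psubst) simp
  also have "\<dots> = (\<Sum>q | tdeg q \<le> ?n. if q = p then cf (subst_monom u v w p) m else 0)"
    unfolding psubst_trunc_def cf_sum by (intro sum.cong) (auto simp: cf_monom)
  also have "\<dots> = cf (subst_monom u v w p) m" by (simp add: finite_tdeg_le)
  finally show "cf (psubst u v w (ps_monom p)) m = cf (subst_monom u v w p) m" .
qed

lemma psubst_xyz: "psubst u v w ps_x = u" "psubst u v w ps_y = v" "psubst u v w ps_z = w"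
  using psubst_of_monom[of "(1, 0, 0)"] psubst_of_monom[of "(0, 1, 0)"] psubst_of_monom[of "(0, 0, 1)"]
  by (simp_all add: ps_monom_def subst_monom_def)

lemma ps_endo_psubst: "ps_endo (psubst u v w)"
  unfolding ps_endo_def
proof (intro conjI allI impI)
  fix f g
  show "psubst u v w (f + g) = psubst u v w f + psubst u v w g"
    by (rule cf_eqI)
      (simp add: psubst_def psubst_trunc_def cf_sum distrib_right sum.distrib)
  show "psubst u v w (f * g) = psubst u v w f * psubst u v w g" by (rule psubst_mult)
next
  fix c
  show "psubst u v w (ps_const c) = ps_const c"
  proof (rule cf_eqI)
    fix m
    have "cf (psubst u v w (ps_const c)) m =
        (\<Sum>q | tdeg q \<le> tdeg m. if q = (0, 0, 0) then cf (ps_const c) m else 0)"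
      by (subst cf_psubst[OF order_refl])
        (auto simp: psubst_trunc_def cf_sum cf_const cf_1 subst_monom_def ps_const_simps intro!: sum.cong)
    also have "\<dots> = cf (ps_const c) m"
      by (simp add: finite_tdeg_le)
    finally show "cf (psubst u v w (ps_const c)) m = cf (ps_const c) m" .
  qed
next
  fix n and f :: "'k ps3" assume "f \<in> ps_ge n"
  then show "psubst u v w f \<in> ps_ge n"
    using psubst_trunc_ge unfolding psubst_def ps_ge_def by simp
qed

end

section \<open>Linear automorphisms and the quadratic part of a series\<close>

definition ps_auto :: "('k::comm_ring_1 ps3 \<Rightarrow> 'k ps3) \<Rightarrow> ('k ps3 \<Rightarrow> 'k ps3) \<Rightarrow> bool" where
  "ps_auto \<phi> \<psi> \<longleftrightarrow> ps_endo \<phi> \<and> ps_endo \<psi> \<and> (\<forall>f. \<psi> (\<phi> f) = f) \<and> (\<forall>f. \<phi> (\<psi> f) = f)"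

lemma ps_autoI:
  assumes "ps_endo \<phi>" "ps_endo \<psi>"
    and "\<psi> (\<phi> ps_x) = ps_x" "\<psi> (\<phi> ps_y) = ps_y" "\<psi> (\<phi> ps_z) = ps_z"
    and "\<phi> (\<psi> ps_x) = ps_x" "\<phi> (\<psi> ps_y) = ps_y" "\<phi> (\<psi> ps_z) = ps_z"
  shows "ps_auto \<phi> \<psi>"
  unfolding ps_auto_def
  using assms ps_endo_eq_id[OF ps_endo_compose[of \<phi> \<psi>]] ps_endo_eq_id[OF ps_endo_compose[of \<psi> \<phi>]]
  by simp

lemma cf_monom_1: "cf ps_x m = (if m = (1, 0, 0) then 1 else 0)"
  "cf ps_y m = (if m = (0, 1, 0) then 1 else 0)" "cf ps_z m = (if m = (0, 0, 1) then 1 else 0)"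
  using cf_monom[of "(1, 0, 0)" m] cf_monom[of "(0, 1, 0)" m] cf_monom[of "(0, 0, 1)" m]
  by (simp_all add: ps_monom_def)

lemma ps_xyz_ge: "ps_x \<in> ps_ge 1" "ps_y \<in> ps_ge 1" "ps_z \<in> ps_ge 1"
  unfolding ps_ge_1_iff cf_monom_1 by simp_all

text \<open>Up to order three \<open>f\<close> is its quadratic part, here called \<open>q\<close>,
  and the coefficient of \<open>x^2\<close> in its image is the value of that quadratic form at the
  vector \<open>(\<alpha>, \<beta>, \<gamma>)\<close>.\<close>

lemma cf_endo_quadric:
  assumes \<phi>: "ps_endo \<phi>" and f: "f \<in> ps_ge 2"
    and \<alpha>: "cf (\<phi> ps_x) (1, 0, 0) = \<alpha>" and \<beta>: "cf (\<phi> ps_y) (1, 0, 0) = \<beta>" and \<gamma>: "cf (\<phi> ps_z) (1, 0, 0) = \<gamma>"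
  shows "cf (\<phi> f) (2, 0, 0) =
    cf f (2, 0, 0) * \<alpha>\<^sup>2 + cf f (0, 2, 0) * \<beta>\<^sup>2 + cf f (0, 0, 2) * \<gamma>\<^sup>2 +
    cf f (1, 1, 0) * (\<alpha> * \<beta>) + cf f (1, 0, 1) * (\<alpha> * \<gamma>) + cf f (0, 1, 1) * (\<beta> * \<gamma>)"
proof -
  define q where "q = ps_const (cf f (2, 0, 0)) * (ps_x * ps_x) + ps_const (cf f (0, 2, 0)) * (ps_y * ps_y)
    + ps_const (cf f (0, 0, 2)) * (ps_z * ps_z) + ps_const (cf f (1, 1, 0)) * (ps_x * ps_y)
    + ps_const (cf f (1, 0, 1)) * (ps_x * ps_z) + ps_const (cf f (0, 1, 1)) * (ps_y * ps_z)"
  have "f - q \<in> ps_ge 3"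
  proof (rule ps_geI)
    fix m assume m: "tdeg m < 3"
    obtain a b c where abc: "m = (a, b, c)" by (cases m)
    have f0: "cf f (0, 0, 0) = 0" "cf f (1, 0, 0) = 0" "cf f (0, 1, 0) = 0" "cf f (0, 0, 1) = 0"
      using f by (auto simp: ps_ge_def)
    have "a \<in> {0, 1, 2}" "b \<in> {0, 1, 2}" "c \<in> {0, 1, 2}" "a + b + c < 3"
      using m by (auto simp: abc)
    then show "cf (f - q) m = 0"
      by (auto simp: abc q_def cf_x_mult cf_y_mult cf_z_mult cf_monom_1 f0[simplified])
  qed
  then have "\<phi> (f - q) \<in> ps_ge 3" by (rule ps_endoD(4)[OF \<phi>])
  then have "cf (\<phi> f) (2, 0, 0) = cf (\<phi> q) (2, 0, 0)"
    using ps_geD[of "\<phi> (f - q)" 3 "(2, 0, 0)"] by (simp add: ps_endo_simps(4)[OF \<phi>])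
  also have "\<dots> = cf f (2, 0, 0) * \<alpha>\<^sup>2 + cf f (0, 2, 0) * \<beta>\<^sup>2 + cf f (0, 0, 2) * \<gamma>\<^sup>2 +
    cf f (1, 1, 0) * (\<alpha> * \<beta>) + cf f (1, 0, 1) * (\<alpha> * \<gamma>) + cf f (0, 1, 1) * (\<beta> * \<gamma>)"
    by (simp add: q_def ps_endoD(1-3)[OF \<phi>] cf_1_mult_1 ps_endoD(4)[OF \<phi>] ps_xyz_ge[simplified] \<alpha>[simplified] \<beta>[simplified] \<gamma>[simplified] power2_eq_square)
  finally show ?thesis .
qed

text \<open>A nonzero quadratic form takes a nonzero value at a basis vector or, if all square
  coefficients vanish, at a sum of two basis vectors. Coordinates are chosen with this vector as the
  direction of the new \<open>x\<close>.\<close>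

lemma ps_auto_quadric:
  fixes f :: "'k::comm_ring_1 ps3"
  assumes f2: "f \<in> ps_ge 2" and f3: "f \<notin> ps_ge 3"
  shows "\<exists>\<phi> \<psi>. ps_auto \<phi> \<psi> \<and> cf (\<phi> f) (2, 0, 0) \<noteq> 0"
proof -
  \<comment> \<open>Each case only has to name a substitution and its inverse. The last premise says
    that the quadratic part is nonzero at the vector of \<open>x\<close>-coefficients of
    \<open>u\<close>, \<open>v\<close>, \<open>w\<close>.\<close>
  have witness: "\<exists>\<phi> \<psi>. ps_auto \<phi> \<psi> \<and> cf (\<phi> f) (2, 0, 0) \<noteq> 0"
    if "u \<in> ps_ge 1" "v \<in> ps_ge 1" "w \<in> ps_ge 1" "u' \<in> ps_ge 1" "v' \<in> ps_ge 1" "w' \<in> ps_ge 1"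
      "psubst u' v' w' u = ps_x" "psubst u' v' w' v = ps_y" "psubst u' v' w' w = ps_z"
      "psubst u v w u' = ps_x" "psubst u v w v' = ps_y" "psubst u v w w' = ps_z"
      "cf f (2, 0, 0) * (cf u (1, 0, 0))\<^sup>2 + cf f (0, 2, 0) * (cf v (1, 0, 0))\<^sup>2
       + cf f (0, 0, 2) * (cf w (1, 0, 0))\<^sup>2 + cf f (1, 1, 0) * (cf u (1, 0, 0) * cf v (1, 0, 0))
       + cf f (1, 0, 1) * (cf u (1, 0, 0) * cf w (1, 0, 0))
       + cf f (0, 1, 1) * (cf v (1, 0, 0) * cf w (1, 0, 0)) \<noteq> 0"
    for u v w u' v' w' :: "'k ps3"
  proof (intro exI conjI)
    show "ps_auto (psubst u v w) (psubst u' v' w')"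
      using that by (intro ps_autoI ps_endo_psubst) (simp_all only: psubst_xyz)
    show "cf (psubst u v w f) (2, 0, 0) \<noteq> 0"
      using that(13) cf_endo_quadric[OF ps_endo_psubst[OF that(1-3)] f2 refl refl refl]
      by (simp only: psubst_xyz[OF that(1-3)] not_False_eq_True)
  qed
  note e = ps_endoD(1)[OF ps_endo_psubst] ps_endo_simps(4)[OF ps_endo_psubst] psubst_xyz
  note ge = ps_xyz_ge ps_ge_add ps_ge_diff
  note s = e ge cf_monom_1
  obtain m where m: "cf f m \<noteq> 0" "tdeg m < 3" using f3 by (auto simp: ps_ge_def)
  then have "tdeg m = 2" using f2 ps_geD[of f 2 m] by fastforce
  moreover obtain a b c where abc: "m = (a, b, c)" by (cases m)
  ultimately have sum: "a + b + c = 2" by simp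
  then have "b = 0 \<or> b = 1 \<or> b = 2" "c = 0 \<or> c = 1 \<or> c = 2" by arith+
  with sum have "(a, b, c) \<in> {(2, 0, 0), (0, 2, 0), (0, 0, 2), (1, 1, 0), (1, 0, 1), (0, 1, 1)}"
    by (elim disjE) simp_all
  with m(1) have "\<exists>p\<in>{(2, 0, 0), (0, 2, 0), (0, 0, 2), (1, 1, 0), (1, 0, 1), (0, 1, 1)}. cf f p \<noteq> 0"
    unfolding abc by (rule bexI)
  then consider "cf f (2, 0, 0) \<noteq> 0" | "cf f (0, 2, 0) \<noteq> 0" | "cf f (0, 0, 2) \<noteq> 0"
    | "cf f (2, 0, 0) = 0" "cf f (0, 2, 0) = 0" "cf f (0, 0, 2) = 0" "cf f (1, 1, 0) \<noteq> 0"
    | "cf f (2, 0, 0) = 0" "cf f (0, 2, 0) = 0" "cf f (0, 0, 2) = 0" "cf f (1, 1, 0) = 0" "cf f (1, 0, 1) \<noteq> 0"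
    | "cf f (2, 0, 0) = 0" "cf f (0, 2, 0) = 0" "cf f (0, 0, 2) = 0" "cf f (1, 1, 0) = 0" "cf f (1, 0, 1) = 0"
      "cf f (0, 1, 1) \<noteq> 0"
    unfolding bex_simps by satx
  then show ?thesis
  proof cases
    case 1
    then show ?thesis by (intro witness[of ps_x ps_y ps_z ps_x ps_y ps_z]) (simp_all add: s[simplified])
  next
    case 2
    then show ?thesis by (intro witness[of ps_y ps_x ps_z ps_y ps_x ps_z]) (simp_all add: s[simplified])
  next
    case 3
    then show ?thesis by (intro witness[of ps_z ps_y ps_x ps_z ps_y ps_x]) (simp_all add: s[simplified])
  next
    case 4
    then show ?thesis
      by (intro witness[of ps_x "ps_y + ps_x" ps_z ps_x "ps_y - ps_x" ps_z]) (simp_all add: s[simplified])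
  next
    case 5
    then show ?thesis
      by (intro witness[of ps_x ps_y "ps_z + ps_x" ps_x ps_y "ps_z - ps_x"]) (simp_all add: s[simplified])
  next
    \<comment> \<open>The direction is \<open>(0, 1, 1)\<close>. Exchanging \<open>x\<close> and
      \<open>y\<close> keeps the substitution invertible, and it is why the inverse subtracts
      \<open>ps_y\<close> rather than \<open>ps_x\<close>.\<close>
    case 6
    then show ?thesis
      by (intro witness[of ps_y ps_x "ps_z + ps_x" ps_y ps_x "ps_z - ps_y"]) (simp_all add: s[simplified])
  qed
qed

section \<open>Ideals and the Hilbert function\<close>

lemma ring_of_type_simps [simp]:
  "carrier ring_of_type_algebra = UNIV"
  "monoid.mult ring_of_type_algebra = (*)"
  "ring.add ring_of_type_algebra = (+)"
  "monoid.one ring_of_type_algebra = 1"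
  "ring.zero ring_of_type_algebra = 0"
  by (simp_all add: ring_of_type_algebra_def)

lemma ring_of_type_a_inv [simp]: "\<ominus>\<^bsub>ring_of_type_algebra\<^esub> a = - (a :: 'a :: comm_ring_1)"
proof -
  interpret cring "ring_of_type_algebra :: 'a ring" by (rule cring_from_type_algebra)
  show ?thesis using minus_equality[of "- a" a] by simp
qed

lemma ideal_ring_of_typeI:
  fixes S :: "'a::comm_ring_1 set"
  assumes "0 \<in> S" "\<And>a b. a \<in> S \<Longrightarrow> b \<in> S \<Longrightarrow> a + b \<in> S" "\<And>a r. a \<in> S \<Longrightarrow> r * a \<in> S"
  shows "ideal S ring_of_type_algebra"
proof (rule idealI)
  show "ring (ring_of_type_algebra :: 'a ring)" by (rule ring_from_type_algebra)
  then interpret ring "ring_of_type_algebra :: 'a ring" .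
  have "- a \<in> S" if "a \<in> S" for a
    using assms(3)[OF that, of "- 1"] by simp
  then show "subgroup S (add_monoid ring_of_type_algebra)"
    using assms by (intro add.subgroupI) (auto simp: a_inv_def[symmetric])
qed (use assms in \<open>auto simp: mult.commute\<close>)

lemma ideal_ring_of_typeD:
  fixes S :: "'a::comm_ring_1 set"
  assumes "ideal S ring_of_type_algebra"
  shows "0 \<in> S" "a \<in> S \<Longrightarrow> b \<in> S \<Longrightarrow> a + b \<in> S" "a \<in> S \<Longrightarrow> r * a \<in> S"
    "a \<in> S \<Longrightarrow> b \<in> S \<Longrightarrow> a - b \<in> S"
proof -
  interpret ideal S "ring_of_type_algebra :: 'a ring" by (rule assms)
  show "0 \<in> S" using additive_subgroup.zero_closed[OF ideal.axioms(1)[OF assms]] by simp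
  show add: "a \<in> S \<Longrightarrow> b \<in> S \<Longrightarrow> a + b \<in> S" for a b
    using additive_subgroup.a_closed[OF ideal.axioms(1)[OF assms]] by simp
  show m: "a \<in> S \<Longrightarrow> r * a \<in> S" for a r using I_l_closed[of a r] by simp
  show "a \<in> S \<Longrightarrow> b \<in> S \<Longrightarrow> a - b \<in> S" using add[of a "- b"] m[of b "- 1"] by simp
qed

lemma genideal_ring_of_type_1:
  fixes f :: "'a::comm_ring_1"
  shows "Idl\<^bsub>ring_of_type_algebra\<^esub> {f} = range (\<lambda>u. u * f)"
proof
  interpret cring "ring_of_type_algebra :: 'a ring" by (rule cring_from_type_algebra)
  have "ideal (range (\<lambda>u. u * f)) ring_of_type_algebra"
    by (rule ideal_ring_of_typeI) (auto simp: distrib_right[symmetric] mult.assoc[symmetric] intro: image_eqI[of _ _ 0])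
  moreover have "f \<in> range (\<lambda>u. u * f)" by (rule image_eqI[of _ _ 1]) auto
  ultimately show "Idl\<^bsub>ring_of_type_algebra\<^esub> {f} \<subseteq> range (\<lambda>u. u * f)"
    by (intro genideal_minimal) auto
  show "range (\<lambda>u. u * f) \<subseteq> Idl\<^bsub>ring_of_type_algebra\<^esub> {f}"
    using ideal_ring_of_typeD(3)[OF genideal_ideal[of "{f}"]] genideal_self'[of f] by auto
qed

lemma genideal_ring_of_type_2:
  fixes f g :: "'a::comm_ring_1"
  shows "Idl\<^bsub>ring_of_type_algebra\<^esub> {f, g} = {u * g + w * f | u w. True}" (is "_ = ?S")
proof
  interpret cring "ring_of_type_algebra :: 'a ring" by (rule cring_from_type_algebra)
  have "ideal ?S ring_of_type_algebra"
  proof (rule ideal_ring_of_typeI)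
    have "0 = 0 * g + 0 * f" by simp
    then show "0 \<in> ?S" by blast
  next
    fix a b assume "a \<in> ?S" "b \<in> ?S"
    then obtain u w u' w' where "a = u * g + w * f" "b = u' * g + w' * f" by blast
    then have "a + b = (u + u') * g + (w + w') * f" by (simp add: algebra_simps)
    then show "a + b \<in> ?S" by blast
  next
    fix a r assume "a \<in> ?S"
    then obtain u w where "a = u * g + w * f" by blast
    then have "r * a = (r * u) * g + (r * w) * f" by (simp add: algebra_simps)
    then show "r * a \<in> ?S" by blast
  qed
  moreover have "f = 0 * g + 1 * f" "g = 1 * g + 0 * f" by simp_all
  then have "{f, g} \<subseteq> ?S" by blast
  ultimately show "Idl\<^bsub>ring_of_type_algebra\<^esub> {f, g} \<subseteq> ?S"
    by (rule genideal_minimal)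
  show "?S \<subseteq> Idl\<^bsub>ring_of_type_algebra\<^esub> {f, g}"
    using ideal_ring_of_typeD(2,3)[OF genideal_ideal[of "{f, g}"]] genideal_self[of "{f, g}"] by auto
qed

text \<open>Every monomial of positive degree is assigned to the first of \<open>x\<close>,
  \<open>y\<close>, \<open>z\<close> that divides it, which gives the three quotients.\<close>

lemma ps_ge_Suc_decomp:
  assumes "f \<in> ps_ge (Suc n)"
  shows "\<exists>p q r. p \<in> ps_ge n \<and> q \<in> ps_ge n \<and> r \<in> ps_ge n \<and> f = ps_x * p + ps_y * q + ps_z * r"
proof (intro exI conjI)
  let ?p = "ps_of_cf (\<lambda>(a, b, c). cf f (Suc a, b, c))"
  let ?q = "ps_of_cf (\<lambda>(a, b, c). if a = 0 then cf f (0, Suc b, c) else 0)"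
  let ?r = "ps_of_cf (\<lambda>(a, b, c). if a = 0 \<and> b = 0 then cf f (0, 0, Suc c) else 0)"
  show "?p \<in> ps_ge n" "?q \<in> ps_ge n" "?r \<in> ps_ge n"
    using assms by (auto simp: ps_ge_def split: prod.splits)
  show "f = ps_x * ?p + ps_y * ?q + ps_z * ?r"
  proof (rule cf_eqI)
    fix m :: expo
    obtain a b c where m: "m = (a, b, c)" by (cases m)
    have "cf f (0, 0, 0) = 0" using assms by (auto simp: ps_ge_def)
    then show "cf f m = cf (ps_x * ?p + ps_y * ?q + ps_z * ?r) m"
      by (auto simp: m cf_x_mult cf_y_mult cf_z_mult)
  qed
qed

lemma ideal_ps_ge: "ideal (ps_ge n) ps_ring"
  unfolding ps_ring_def by (rule ideal_ring_of_typeI) (auto intro: ps_ge_add ps_ge_mult_left)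

lemma ps_max_ideal_eq: "ps_max_ideal = (ps_ge 1 :: 'k::comm_ring_1 ps3 set)"
proof
  interpret ring "ps_ring :: 'k ps3 ring" unfolding ps_ring_def by (rule ring_from_type_algebra)
  show "ps_max_ideal \<subseteq> (ps_ge 1 :: 'k ps3 set)"
    unfolding ps_max_ideal_def
    by (rule genideal_minimal[OF ideal_ps_ge]) (use ps_xyz_ge in auto)
  show "(ps_ge 1 :: 'k ps3 set) \<subseteq> ps_max_ideal"
  proof
    fix f :: "'k ps3" assume "f \<in> ps_ge 1"
    then obtain p q r where f: "f = p * ps_x + q * ps_y + r * ps_z"
      using ps_ge_Suc_decomp[of f 0] by (auto simp: mult.commute)
    have c: "{ps_x, ps_y, ps_z} \<subseteq> carrier (ps_ring :: 'k ps3 ring)" by (simp add: ps_ring_def)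
    have m: "ps_x \<in> (ps_max_ideal :: 'k ps3 set)" "ps_y \<in> (ps_max_ideal :: 'k ps3 set)"
      "ps_z \<in> (ps_max_ideal :: 'k ps3 set)"
      using genideal_self[OF c] unfolding ps_max_ideal_def by auto
    have "ideal (ps_max_ideal :: 'k ps3 set) ring_of_type_algebra"
      using genideal_ideal[OF c] unfolding ps_max_ideal_def by (simp add: ps_ring_def)
    note cl = ideal_ring_of_typeD(2,3)[OF this]
    show "f \<in> ps_max_ideal" unfolding f using m by (intro cl)
  qed
qed

text \<open>One step in computing the powers of the maximal ideal of a quotient ring. The inclusion
  from right to left splits off one variable from each term.\<close>

lemma image_ps_ge_Suc:
  fixes \<pi> :: "'k::comm_ring_1 ps3 \<Rightarrow> 'b"
  assumes "ring_hom_ring ps_ring A \<pi>"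
  shows "ideal_prod A (\<pi> ` ps_ge t) (\<pi> ` ps_ge 1) = \<pi> ` ps_ge (Suc t)"
proof
  interpret ring_hom_ring "ps_ring :: 'k ps3 ring" A \<pi> by (rule assms)
  have hom: "\<pi> a \<otimes>\<^bsub>A\<^esub> \<pi> b = \<pi> (a * b)" "\<pi> a \<oplus>\<^bsub>A\<^esub> \<pi> b = \<pi> (a + b)" for a b
    using hom_mult[of a b] hom_add[of a b] by (simp_all add: ps_ring_def)
  show "ideal_prod A (\<pi> ` ps_ge t) (\<pi> ` ps_ge 1) \<subseteq> \<pi> ` ps_ge (Suc t)"
  proof
    fix s assume "s \<in> ideal_prod A (\<pi> ` ps_ge t) (\<pi> ` ps_ge 1)"
    then show "s \<in> \<pi> ` ps_ge (Suc t)"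
    proof induction
      case (prod i j)
      then obtain a b where ab: "i = \<pi> a" "j = \<pi> b" "a \<in> ps_ge t" "b \<in> ps_ge 1" by blast
      have "a * b \<in> ps_ge (Suc t)" using ps_ge_mult[OF ab(3,4)] by simp
      with ab show ?case by (auto simp: hom)
    next
      case (sum s1 s2)
      then show ?case by (auto simp: hom intro: ps_ge_add)
    qed
  qed
  show "\<pi> ` ps_ge (Suc t) \<subseteq> ideal_prod A (\<pi> ` ps_ge t) (\<pi> ` ps_ge 1)"
  proof (rule image_subsetI)
    fix f :: "'k ps3" assume "f \<in> ps_ge (Suc t)"
    then obtain p q r where pqr: "p \<in> ps_ge t" "q \<in> ps_ge t" "r \<in> ps_ge t"
      and f: "f = p * ps_x + q * ps_y + r * ps_z"
      using ps_ge_Suc_decomp[of f t] by (auto simp: mult.commute)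
    let ?P = "ideal_prod A (\<pi> ` ps_ge t) (\<pi> ` ps_ge 1)"
    have pr: "\<pi> a \<otimes>\<^bsub>A\<^esub> \<pi> b \<in> ?P" if "a \<in> ps_ge t" "b \<in> ps_ge 1" for a b
      using that by (intro ideal_prod.prod) auto
    have "\<pi> f = \<pi> p \<otimes>\<^bsub>A\<^esub> \<pi> ps_x \<oplus>\<^bsub>A\<^esub> \<pi> q \<otimes>\<^bsub>A\<^esub> \<pi> ps_y \<oplus>\<^bsub>A\<^esub> \<pi> r \<otimes>\<^bsub>A\<^esub> \<pi> ps_z"
      by (simp add: f hom)
    also have "\<dots> \<in> ?P"
      by (intro ideal_prod.sum pr pqr ps_xyz_ge)
    finally show "\<pi> f \<in> ?P" .
  qed
qed

lemma subfield_ps_const: "subfield (range ps_const) (ps_ring :: 'k::field ps3 ring)"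
proof -
  interpret K: Ring.field "ring_of_type_algebra :: 'k ring" by (rule field_from_type_algebra)
  interpret R: ring "ps_ring :: 'k ps3 ring" unfolding ps_ring_def by (rule ring_from_type_algebra)
  have "ps_const \<in> ring_hom (ring_of_type_algebra :: 'k ring) ps_ring"
    by (rule ring_hom_memI) (simp_all add: ps_ring_def ps_const_simps)
  then interpret h: ring_hom_ring "ring_of_type_algebra :: 'k ring" ps_ring ps_const
    by (intro ring_hom_ringI2 K.ring_axioms R.ring_axioms)
  have "subfield UNIV (ring_of_type_algebra :: 'k ring)"
    using K.carrier_is_subfield by simp
  then show ?thesis by (rule h.img_is_subfield(2)) (simp add: ps_ring_def)
qed

text \<open>Replaces the dimension in a twofold quotient by two conditions on power series: the
  family \<open>e\<close> is a basis of \<open>M^t\<close> modulo \<open>I\<close> and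
  \<open>M^(t+1)\<close>, where \<open>M\<close> is the maximal ideal.\<close>

lemma HF_eq_card:
  fixes I :: "'k::field ps3 set" and e :: "'b \<Rightarrow> 'k ps3"
  assumes I: "ideal I ps_ring" and I1: "I \<subseteq> ps_ge 1" and S: "finite S"
    and e: "\<And>m. m \<in> S \<Longrightarrow> e m \<in> ps_ge t"
    and indep: "\<And>c u. u \<in> I \<Longrightarrow> (\<Sum>m\<in>S. ps_const (c m) * e m) - u \<in> ps_ge (Suc t) \<Longrightarrow> \<forall>m\<in>S. c m = 0"
    and span: "\<And>v. v \<in> ps_ge t \<Longrightarrow> \<exists>c. \<exists>u\<in>I. v - (\<Sum>m\<in>S. ps_const (c m) * e m) - u \<in> ps_ge (Suc t)"
  shows "HF I t = card S"
proof -
  interpret R: ring "ps_ring :: 'k ps3 ring" unfolding ps_ring_def by (rule ring_from_type_algebra)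
  interpret I: ideal I ps_ring by (rule I)
  define A where "A = ps_ring Quot I"
  define \<pi> where "\<pi> = (\<lambda>x. I +>\<^bsub>ps_ring\<^esub> x)"
  have \<pi>: "ring_hom_ring ps_ring A \<pi>" unfolding A_def \<pi>_def by (rule I.rcos_ring_hom_ring)
  then interpret \<pi>: ring_hom_ring ps_ring A \<pi> .
  define J where "J = \<pi> ` ps_ge (Suc t)"
  have carrier_A: "carrier A = \<pi> ` ps_ge 0"
    by (auto simp: A_def \<pi>_def FactRing_def A_RCOSETS_def RCOSETS_def a_r_coset_def ps_ring_def)
  have pow: "(\<pi> ` ps_ge 1) [^]\<^bsub>ideals_set A\<^esub> n = \<pi> ` ps_ge n" for n
  proof (induction n)
    case 0
    then show ?case using carrier_A by (simp add: ideals_set_def)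
  next
    case (Suc n)
    have "(\<pi> ` ps_ge 1) [^]\<^bsub>ideals_set A\<^esub> Suc n = ideal_prod A (\<pi> ` ps_ge n) (\<pi> ` ps_ge 1)"
      unfolding nat_pow_Suc Suc.IH by (simp add: ideals_set_def)
    then show ?case using image_ps_ge_Suc[OF \<pi>] by simp
  qed
  have J: "ideal J A"
    unfolding J_def A_def \<pi>_def by (rule R.ring_ideal_imp_quot_ideal[OF I ideal_ps_ge])
  then interpret J: ideal J A .
  define B where "B = A Quot J"
  \<comment> \<open>Both quotients are collapsed into one homomorphism from the series ring, with
    kernel \<open>I + M^(t+1)\<close>.\<close>
  define h where "h = (\<lambda>x. J +>\<^bsub>A\<^esub> \<pi> x)"
  have hB: "ring_hom_ring ps_ring B h"
  proof (rule ring_hom_ringI2)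
    show "ring B" unfolding B_def by (rule J.quotient_is_ring)
    have "(\<lambda>y. J +>\<^bsub>A\<^esub> y) \<circ> \<pi> \<in> ring_hom ps_ring B"
      unfolding B_def by (rule ring_hom_trans[OF \<pi>.homh J.rcos_ring_hom])
    then show "h \<in> ring_hom ps_ring B" by (simp add: h_def comp_def)
  qed (rule R.ring_axioms)
  then interpret h: ring_hom_ring ps_ring B h .
  have hom: "h a \<otimes>\<^bsub>B\<^esub> h b = h (a * b)" "h a \<oplus>\<^bsub>B\<^esub> h b = h (a + b)" "\<zero>\<^bsub>B\<^esub> = h 0" "\<one>\<^bsub>B\<^esub> = h 1" for a b
    using h.hom_mult[of a b] h.hom_add[of a b] h.hom_zero h.hom_one by (simp_all add: ps_ring_def)
  have \<pi>_eq: "\<pi> a = \<pi> b \<longleftrightarrow> a - b \<in> I" for a b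
    unfolding \<pi>_def
    by (subst R.quotient_eq_iff_same_a_r_cos[OF I, symmetric])
      (simp_all add: a_minus_def ps_ring_def)
  have h0: "h a = \<zero>\<^bsub>B\<^esub> \<longleftrightarrow> (\<exists>u\<in>I. a - u \<in> ps_ge (Suc t))" for a
  proof -
    have "h a = \<zero>\<^bsub>B\<^esub> \<longleftrightarrow> \<pi> a \<in> J"
    proof
      assume "h a = \<zero>\<^bsub>B\<^esub>"
      then have "J +>\<^bsub>A\<^esub> \<pi> a = J" by (simp add: h_def B_def FactRing_def)
      moreover have "\<pi> a \<in> carrier A" by (simp add: carrier_A)
      ultimately show "\<pi> a \<in> J" using J.a_rcos_self by blast
    next
      assume "\<pi> a \<in> J"
      then have "J +>\<^bsub>A\<^esub> \<pi> a = J" by (rule \<pi>.S.a_rcos_zero[OF J])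
      then show "h a = \<zero>\<^bsub>B\<^esub>" by (simp add: h_def B_def FactRing_def)
    qed
    also have "\<dots> \<longleftrightarrow> (\<exists>u\<in>I. a - u \<in> ps_ge (Suc t))"
    proof
      assume "\<pi> a \<in> J"
      then obtain s where "s \<in> ps_ge (Suc t)" "a - s \<in> I" by (auto simp: J_def \<pi>_eq)
      then show "\<exists>u\<in>I. a - u \<in> ps_ge (Suc t)" by (intro bexI[of _ "a - s"]) auto
    next
      assume "\<exists>u\<in>I. a - u \<in> ps_ge (Suc t)"
      then obtain u where u: "u \<in> I" "a - u \<in> ps_ge (Suc t)" by blast
      then have "\<pi> a = \<pi> (a - u)" by (simp add: \<pi>_eq)
      with u(2) show "\<pi> a \<in> J" by (auto simp: J_def)
    qed
    finally show ?thesis .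
  qed
  have h_eq: "h a = h b" if "h (a - b) = \<zero>\<^bsub>B\<^esub>" for a b
  proof -
    have "h a = h (a - b) \<oplus>\<^bsub>B\<^esub> h b" by (simp add: hom)
    also have "\<dots> = h b" using that hom(2)[of 0 b] by (simp add: hom)
    finally show ?thesis .
  qed
  \<comment> \<open>If \<open>u\<close> lies in \<open>I\<close>, then \<open>1 - u\<close> has
    constant term 1. Hence \<open>B\<close> is not the zero ring, as is required for the image of
    \<open>K\<close> to be a field.\<close>
  have "h 1 \<noteq> \<zero>\<^bsub>B\<^esub>"
  proof
    assume "h 1 = \<zero>\<^bsub>B\<^esub>"
    then obtain u where u: "u \<in> I" "1 - u \<in> ps_ge (Suc t)" using h0 by blast
    then have "u \<in> ps_ge 1" "1 - u \<in> ps_ge 1" using I1 ps_ge_mono[of _ "Suc t" 1] by auto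
    then have "1 \<in> (ps_ge 1 :: 'k ps3 set)" using ps_ge_add[of u 1 "1 - u"] by simp
    then show False unfolding ps_ge_1_iff by (simp add: cf_1)
  qed
  then have K: "subfield (h ` range ps_const) B"
    by (intro h.img_is_subfield(2)[OF subfield_ps_const]) (simp add: hom)
  obtain ms where ms: "set ms = S" "distinct ms" using finite_distinct_list[OF S] by blast
  define Us where "Us = map (\<lambda>m. h (e m)) ms"
  have Us: "set Us \<subseteq> carrier B" using h.hom_closed by (auto simp: Us_def ps_ring_def)
  have comb: "h.S.combine (map (\<lambda>m. h (ps_const (c m))) ms') (map (\<lambda>m. h (e m)) ms') =
      h (\<Sum>m\<leftarrow>ms'. ps_const (c m) * e m)" for c ms'
    by (induction ms') (simp_all add: hom)
  have comb': "h.S.combine (map (\<lambda>m. h (ps_const (c m))) ms) Us =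
      h (\<Sum>m\<in>S. ps_const (c m) * e m)" for c
    unfolding Us_def comb using ms by (simp add: sum_list_distinct_conv_sum_set)
  \<comment> \<open>Scalar lists are turned into functions on the index set; distinctness of the
    indices makes the function well defined.\<close>
  have Ks_ex: "\<exists>c. Ks = map (\<lambda>m. h (ps_const (c m))) ms'"
    if "set Ks \<subseteq> h ` range ps_const" "length Ks = length ms'" "distinct ms'" for Ks ms'
    using that
  proof (induction ms' arbitrary: Ks)
    case (Cons m ms')
    then obtain k Ks' where Ks: "Ks = k # Ks'" by (cases Ks) auto
    with Cons obtain c where c: "Ks' = map (\<lambda>m. h (ps_const (c m))) ms'" by force
    obtain d where "k = h (ps_const d)" using Cons.prems(1) Ks by auto
    then have "Ks = map (\<lambda>m'. h (ps_const ((c(m := d)) m'))) (m # ms')"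
      using Cons.prems(3) by (auto simp: Ks c)
    then show ?case by blast
  qed simp
  have "h.S.independent (h ` range ps_const) Us"
  proof (rule ccontr)
    assume dep: "\<not> h.S.independent (h ` range ps_const) Us"
    then obtain Ks where Ks: "length Ks = length Us" "h.S.combine Ks Us = \<zero>\<^bsub>B\<^esub>"
      "set Ks \<subseteq> h ` range ps_const" "set Ks \<noteq> {\<zero>\<^bsub>B\<^esub>}"
      using h.S.dependent_imp_non_trivial_combine[OF K Us] by metis
    then obtain c where c: "Ks = map (\<lambda>m. h (ps_const (c m))) ms"
      using Ks_ex[of Ks ms] ms by (auto simp: Us_def)
    then obtain u where "u \<in> I" "(\<Sum>m\<in>S. ps_const (c m) * e m) - u \<in> ps_ge (Suc t)"
      using Ks(2) h0 comb' by metis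
    then have "\<forall>m\<in>S. c m = 0" by (rule indep)
    then have "set Ks \<subseteq> {\<zero>\<^bsub>B\<^esub>}" using c ms(1) by (auto simp: hom ps_const_simps)
    \<comment> \<open>The empty list also differs from a list of zeros as a set, so it has to be
      excluded separately: an empty family is independent.\<close>
    moreover have "Us \<noteq> []" using dep by auto
    then have "set Ks \<noteq> {}" using Ks(1) by auto
    ultimately show False using Ks(4) by (metis subset_singletonD)
  qed
  moreover have "h.S.Span (h ` range ps_const) Us = h ` ps_ge t"
  proof
    show "h.S.Span (h ` range ps_const) Us \<subseteq> h ` ps_ge t"
    proof
      fix v assume "v \<in> h.S.Span (h ` range ps_const) Us"
      then obtain Ks where Ks: "set Ks \<subseteq> h ` range ps_const" "length Ks = length Us" "v = h.S.combine Ks Us"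
        using h.S.Span_mem_iff_length_version[OF K Us] by blast
      then obtain c where "Ks = map (\<lambda>m. h (ps_const (c m))) ms"
        using Ks_ex[of Ks ms] ms by (auto simp: Us_def)
      then have "v = h (\<Sum>m\<in>S. ps_const (c m) * e m)" using Ks(3) comb' by simp
      then show "v \<in> h ` ps_ge t" using e by (auto intro!: imageI ps_ge_sum ps_ge_mult_left)
    qed
    show "h ` ps_ge t \<subseteq> h.S.Span (h ` range ps_const) Us"
    proof (rule image_subsetI)
      fix v :: "'k ps3" assume "v \<in> ps_ge t"
      then obtain c u where "u \<in> I" "v - (\<Sum>m\<in>S. ps_const (c m) * e m) - u \<in> ps_ge (Suc t)"
        using span by blast
      then have "h v = h (\<Sum>m\<in>S. ps_const (c m) * e m)" using h0 by (intro h_eq) blast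
      also have "\<dots> = h.S.combine (map (\<lambda>m. h (ps_const (c m))) ms) Us" by (simp add: comb')
      finally show "h v \<in> h.S.Span (h ` range ps_const) Us"
        unfolding h.S.Span_mem_iff_length_version[OF K Us]
        by (intro exI[of _ "map (\<lambda>m. h (ps_const (c m))) ms"]) (auto simp: Us_def)
    qed
  qed
  ultimately have "h.S.dimension (length Us) (h ` range ps_const) (h ` ps_ge t)"
    by (rule h.S.dimensionI[OF K])
  then have "h.S.dim (h ` range ps_const) (h ` ps_ge t) = length Us"
    using h.S.dimI[OF K] by (simp add: over_def)
  moreover have "HF I t = h.S.dim (h ` range ps_const) (h ` ps_ge t)"
    unfolding HF_def Let_def hilbert_function_def ps_max_ideal_eq
    unfolding A_def[symmetric] \<pi>_def[symmetric]
    unfolding pow J_def[symmetric] B_def[symmetric] by (simp add: image_image h_def)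
  moreover have "length Us = card S" using ms distinct_card by (fastforce simp: Us_def)
  ultimately show ?thesis by simp
qed

section \<open>Division by a quadric\<close>

text \<open>For \<open>n = 1\<close> these are the series in \<open>K[[y,z]]\<close>; for
  \<open>n = 2\<close> they are the combinations of \<open>1\<close> and \<open>x\<close> over that
  ring, the normal forms modulo the quadric.\<close>

definition xdeg_less :: "nat \<Rightarrow> 'k::comm_ring_1 ps3 set" where
  "xdeg_less n = {f. \<forall>m. n \<le> fst m \<longrightarrow> cf f m = 0}"

lemma xltI: "(\<And>m. n \<le> fst m \<Longrightarrow> cf f m = 0) \<Longrightarrow> f \<in> xdeg_less n"
  by (simp add: xdeg_less_def)

lemma xltD: "f \<in> xdeg_less n \<Longrightarrow> n \<le> fst m \<Longrightarrow> cf f m = 0"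
  by (simp add: xdeg_less_def)

lemma xdeg_less_diff: "f \<in> xdeg_less n \<Longrightarrow> g \<in> xdeg_less n \<Longrightarrow> f - g \<in> xdeg_less n"
  by (simp add: xdeg_less_def)

lemma xdeg_less_sum: "(\<And>x. x \<in> A \<Longrightarrow> F x \<in> xdeg_less n) \<Longrightarrow> sum F A \<in> xdeg_less n"
  by (simp add: xdeg_less_def cf_sum)

lemma xdeg_less_mono: "f \<in> xdeg_less m \<Longrightarrow> m \<le> n \<Longrightarrow> f \<in> xdeg_less n"
  by (auto simp: xdeg_less_def)

lemma xdeg_less_mult:
  assumes "f \<in> xdeg_less (Suc m)" "g \<in> xdeg_less (Suc n)"
  shows "f * g \<in> xdeg_less (Suc (m + n))"
proof (rule xltI)
  fix r :: expo assume r: "Suc (m + n) \<le> fst r"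
  have "cf f p * cf g q = 0" if "p + q = r" for p q
  proof -
    have "fst p + fst q = fst r" using that by auto
    then have "Suc m \<le> fst p \<or> Suc n \<le> fst q" using r by linarith
    then show ?thesis using assms by (auto dest: xltD)
  qed
  then show "cf (f * g) r = 0" unfolding cf_mult by (intro sum.neutral) auto
qed

lemma xdeg_less_1_mult: "f \<in> xdeg_less 1 \<Longrightarrow> g \<in> xdeg_less (Suc n) \<Longrightarrow> f * g \<in> xdeg_less (Suc n)"
  using xdeg_less_mult[of f 0 g n] by simp

lemma xdeg_less_xyz: "ps_x \<in> xdeg_less 2" "ps_y \<in> xdeg_less 1" "ps_z \<in> xdeg_less 1"
  by (auto simp: xdeg_less_def cf_monom_1)

section \<open>Division with remainder, lifted one variable at a time\<close>

fun fps_quot :: "('a::comm_ring_1 \<Rightarrow> 'a) \<Rightarrow> 'a fps \<Rightarrow> 'a fps \<Rightarrow> nat \<Rightarrow> 'a" where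
  "fps_quot d f h n = d (fps_nth h n - (\<Sum>i<n. fps_quot d f h i * fps_nth f (n - i)))"

declare fps_quot.simps [simp del]

text \<open>The \<open>n\<close>-th coefficient of the remainder involves the new quotient
  coefficient only through its product with the constant coefficient of \<open>f\<close>. The
  quotient is found recursively, \<open>d\<close> choosing each coefficient by division in the
  smaller ring.\<close>

lemma fps_division_lift:
  fixes f h :: "'a::comm_ring_1 fps"
  assumes "\<And>a. \<exists>q. a - q * fps_nth f 0 \<in> W"
  shows "\<exists>q. \<forall>n. fps_nth (h - q * f) n \<in> W"
proof -
  obtain d where d: "a - d a * fps_nth f 0 \<in> W" for a using assms by metis
  let ?q = "fps_quot d f h"
  have "fps_nth (h - Abs_fps ?q * f) n \<in> W" for n
  proof -
    have "fps_nth (h - Abs_fps ?q * f) n = fps_nth h n - (\<Sum>i=0..n. ?q i * fps_nth f (n - i))"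
      by (simp add: fps_mult_nth)
    also have "{0..n} = insert n {..<n}" by auto
    also have "fps_nth h n - (\<Sum>i\<in>insert n {..<n}. ?q i * fps_nth f (n - i)) =
        (fps_nth h n - (\<Sum>i<n. ?q i * fps_nth f (n - i))) - ?q n * fps_nth f 0"
      by simp
    also have "\<dots> \<in> W" using d by (subst (2) fps_quot.simps)
    finally show ?thesis .
  qed
  then show ?thesis by blast
qed

text \<open>Base case in \<open>K[[x]]\<close>: \<open>f\<close> is a unit times \<open>x^2\<close>,
  so the terms of \<open>h\<close> from \<open>x^2\<close> on are a multiple of
  \<open>f\<close>.\<close>

lemma fps_division_order_2:
  fixes f h :: "'k::field fps"
  assumes "fps_nth f 0 = 0" "fps_nth f 1 = 0" "fps_nth f 2 \<noteq> 0"
  shows "\<exists>q. h - q * f \<in> {r. \<forall>n\<ge>2. fps_nth r n = 0}"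
proof -
  let ?u = "fps_shift 2 f"
  have f: "f = ?u * fps_X ^ 2"
  proof (rule fps_ext)
    fix n :: nat
    consider "n = 0" | "n = 1" | k where "n = k + 2" by (metis One_nat_def add_2_eq_Suc' not0_implies_Suc)
    then show "fps_nth f n = fps_nth (?u * fps_X ^ 2) n"
      using assms(1,2) by cases (auto simp: fps_X_power_mult_right_nth)
  qed
  have u: "inverse ?u * ?u = 1" using assms(3) by (intro inverse_mult_eq_1) (simp add: numeral_2_eq_2)
  have "(fps_shift 2 h * inverse ?u) * f = fps_shift 2 h * (inverse ?u * ?u) * fps_X ^ 2"
    by (subst f) (simp only: mult_ac)
  also have "\<dots> = fps_shift 2 h * fps_X ^ 2" by (simp only: u mult_1_right)
  finally have e: "(fps_shift 2 h * inverse ?u) * f = fps_shift 2 h * fps_X ^ 2" .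
  have "fps_nth (h - (fps_shift 2 h * inverse ?u) * f) n = 0" if "n \<ge> 2" for n
  proof -
    have "n - 2 + 2 = n" using that by simp
    then show ?thesis unfolding e using that by (simp only: fps_sub_nth fps_X_power_mult_right_nth fps_shift_nth) simp
  qed
  then show ?thesis by blast
qed

text \<open>Weierstrass division: by assumption \<open>f(x,0,0)\<close> has order two, and the
  division in \<open>K[[x]]\<close> is lifted first through \<open>y\<close>, then through
  \<open>z\<close>.\<close>

lemma ps_division:
  fixes f h :: "'k::field ps3"
  assumes "cf f (0, 0, 0) = 0" "cf f (1, 0, 0) = 0" "cf f (2, 0, 0) \<noteq> 0"
  shows "\<exists>q. h - q * f \<in> xdeg_less 2"
proof -
  let ?W1 = "{r :: 'k fps. \<forall>n\<ge>2. fps_nth r n = 0}"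
  let ?W2 = "{r. \<forall>n. fps_nth r n \<in> ?W1}"
  have 1: "\<exists>q. a - q * fps_nth (fps_nth f 0) 0 \<in> ?W1" for a
    using assms by (intro fps_division_order_2) (simp_all add: cf_triple)
  have 2: "\<exists>q. a - q * fps_nth f 0 \<in> ?W2" for a
    using fps_division_lift[OF 1] by blast
  obtain q where q: "fps_nth (h - q * f) n \<in> ?W2" for n
    using fps_division_lift[OF 2] by blast
  have "h - q * f \<in> xdeg_less 2"
  proof (rule xltI)
    fix m :: expo assume "2 \<le> fst m"
    then show "cf (h - q * f) m = 0" using q by (cases m) (simp add: cf_triple)
  qed
  then show ?thesis by blast
qed

section \<open>The subring \<open>K[[y]]\<close> and linear relations over it\<close>

definition ps_of_y :: "'k::comm_ring_1 fps \<Rightarrow> 'k ps3" where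
  "ps_of_y p = fps_const (Abs_fps (\<lambda>n. fps_const (fps_nth p n)))"

lemma cf_ps_of_y: "cf (ps_of_y p) (a, b, c) = (if a = 0 \<and> c = 0 then fps_nth p b else 0)"
  by (auto simp: cf_triple ps_of_y_def)

lemma ps_of_y_add: "ps_of_y (p + q) = ps_of_y p + ps_of_y q"
proof (rule cf_eqI)
  fix m show "cf (ps_of_y (p + q)) m = cf (ps_of_y p + ps_of_y q) m"
    by (cases m) (simp add: cf_ps_of_y)
qed

lemma ps_of_y_mult: "ps_of_y (p * q) = ps_of_y p * ps_of_y q"
  unfolding ps_of_y_def
  by (subst fps_const_mult, rule arg_cong[of _ _ fps_const], rule fps_ext)
    (simp add: fps_mult_nth flip: fps_const_mult, simp add: fps_sum_nth fps_eq_iff)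

lemma ps_of_y_0 [simp]: "ps_of_y 0 = 0"
  by (simp add: ps_of_y_def fps_eq_iff)

lemma ps_of_y_xdeg_less: "ps_of_y p \<in> xdeg_less 1"
proof (rule xltI)
  fix m :: expo assume "1 \<le> fst m" then show "cf (ps_of_y p) m = 0"
    by (cases m) (simp add: cf_ps_of_y)
qed

lemma cf_ps_of_y_mult:
  assumes "r \<in> ps_ge j" "tdeg m \<le> j"
  shows "cf (ps_of_y p * r) m = fps_nth p 0 * cf r m"
proof -
  have "ps_of_y p - ps_const (fps_nth p 0) \<in> ps_ge 1"
    unfolding ps_ge_1_iff by (simp add: cf_ps_of_y cf_const)
  then have "(ps_of_y p - ps_const (fps_nth p 0)) * r \<in> ps_ge (1 + j)"
    using assms(1) by (rule ps_ge_mult)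
  then have "cf ((ps_of_y p - ps_const (fps_nth p 0)) * r) m = 0"
    using assms(2) by (intro ps_geD) auto
  then show ?thesis by (simp add: left_diff_distrib)
qed

text \<open>Modulo \<open>z\<close> the normal forms are a module over \<open>K[[y]]\<close>
  generated by \<open>1\<close> and \<open>x\<close>; this rank two limits the growth of the leading
  exponents.\<close>

lemma xdeg_less_2_mod_z:
  fixes s :: "'k::comm_ring_1 ps3"
  assumes "s \<in> xdeg_less 2"
  shows "\<exists>p q t. s = ps_of_y p + ps_of_y q * ps_x + ps_z * t"
proof (intro exI)
  let ?p = "Abs_fps (\<lambda>b. cf s (0, b, 0))" and ?q = "Abs_fps (\<lambda>b. cf s (1, b, 0))"
  let ?t = "ps_of_cf (\<lambda>(a, b, c). cf s (a, b, Suc c))"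
  show "s = ps_of_y ?p + ps_of_y ?q * ps_x + ps_z * ?t"
  proof (rule cf_eqI)
    fix m :: expo
    obtain a b c where m: "m = (a, b, c)" by (cases m)
    have "a = 0 \<or> a = 1 \<or> 2 \<le> a" by arith
    then show "cf s m = cf (ps_of_y ?p + ps_of_y ?q * ps_x + ps_z * ?t) m"
      using xltD[OF assms, of m]
      by (auto simp: m mult.commute[of _ ps_x] cf_x_mult cf_z_mult cf_ps_of_y)
  qed
qed

lemma fps_dvd_linear: "(p :: 'k::field fps) dvd q \<or> q dvd p"
proof (cases "p = 0 \<or> q = 0")
  case False
  then show ?thesis using linorder_linear by (simp add: fps_dvd_iff)
qed auto

text \<open>Three vectors in a module of rank two over a discrete valuation ring. Some first
  coordinate divides the other two and is used as pivot; of the two second coordinates left after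
  elimination one divides the other, which yields a relation with coefficient 1.\<close>

lemma fps_relation_pair:
  fixes A B :: "nat \<Rightarrow> 'k::field fps"
  shows "\<exists>k. (\<exists>i<3. fps_nth (k i) 0 \<noteq> 0) \<and> (\<Sum>i<3. k i * A i) = 0 \<and> (\<Sum>i<3. k i * B i) = 0"
proof -
  have three: "(\<Sum>i<3. F i) = F 0 + F 1 + F 2" for F :: "nat \<Rightarrow> 'k fps"
    by (simp add: eval_nat_numeral)
  have main: "\<exists>k0 k1 k2. (fps_nth k0 0 \<noteq> 0 \<or> fps_nth k1 0 \<noteq> 0 \<or> fps_nth k2 0 \<noteq> 0) \<and>
      k0 * a0 + k1 * a1 + k2 * a2 = 0 \<and> k0 * b0 + k1 * b1 + k2 * b2 = 0"
    if "a0 dvd a1" "a0 dvd a2" for a0 a1 a2 b0 b1 b2 :: "'k fps"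
  proof -
    obtain c1 c2 where c: "a1 = a0 * c1" "a2 = a0 * c2" using \<open>a0 dvd a1\<close> \<open>a0 dvd a2\<close> by (auto elim!: dvdE)
    from fps_dvd_linear[of "b1 - c1 * b0" "b2 - c2 * b0"] show ?thesis
    proof
      assume "b1 - c1 * b0 dvd b2 - c2 * b0"
      then obtain d where "b2 - c2 * b0 = (b1 - c1 * b0) * d" by (auto elim: dvdE)
      then have "b2 = (b1 - c1 * b0) * d + c2 * b0" by (simp add: diff_eq_eq)
      then show ?thesis using c
        by (intro exI[of _ "d * c1 - c2"] exI[of _ "- d"] exI[of _ 1]) (simp add: algebra_simps)
    next
      assume "b2 - c2 * b0 dvd b1 - c1 * b0"
      then obtain d where "b1 - c1 * b0 = (b2 - c2 * b0) * d" by (auto elim: dvdE)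
      then have "b1 = (b2 - c2 * b0) * d + c1 * b0" by (simp add: diff_eq_eq)
      then show ?thesis using c
        by (intro exI[of _ "d * c2 - c1"] exI[of _ 1] exI[of _ "- d"]) (simp add: algebra_simps)
    qed
  qed
  consider "A 0 dvd A 1" "A 0 dvd A 2" | "A 1 dvd A 0" "A 1 dvd A 2" | "A 2 dvd A 0" "A 2 dvd A 1"
    using fps_dvd_linear dvd_trans by metis
  then have "\<exists>k0 k1 k2. (fps_nth k0 0 \<noteq> 0 \<or> fps_nth k1 0 \<noteq> 0 \<or> fps_nth k2 0 \<noteq> 0) \<and>
      k0 * A 0 + k1 * A 1 + k2 * A 2 = 0 \<and> k0 * B 0 + k1 * B 1 + k2 * B 2 = 0"
  proof cases
    case 1
    then show ?thesis by (rule main)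
  next
    case 2
    from main[OF this, of "B 1" "B 0" "B 2"] show ?thesis by (auto simp: ac_simps)
  next
    case 3
    from main[OF this, of "B 2" "B 0" "B 1"] show ?thesis by (auto simp: ac_simps)
  qed
  then obtain k0 k1 k2 where k: "fps_nth k0 0 \<noteq> 0 \<or> fps_nth k1 0 \<noteq> 0 \<or> fps_nth k2 0 \<noteq> 0"
      "k0 * A 0 + k1 * A 1 + k2 * A 2 = 0" "k0 * B 0 + k1 * B 1 + k2 * B 2 = 0" by blast
  define k where "k = (\<lambda>i::nat. if i = 0 then k0 else if i = 1 then k1 else k2)"
  have "k 0 = k0" "k 1 = k1" "k 2 = k2" by (simp_all add: k_def)
  then have "(\<exists>i<3. fps_nth (k i) 0 \<noteq> 0) \<and> (\<Sum>i<3. k i * A i) = 0 \<and> (\<Sum>i<3. k i * B i) = 0"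
    unfolding three using k by (metis One_nat_def numeral_3_eq_3 zero_less_Suc lessI less_SucI numeral_2_eq_2)
  then show ?thesis by blast
qed

section \<open>The ideal \<open>(f, g)\<close> and the leading exponents of its reduced
  elements\<close>

definition pideal :: "'k::comm_ring_1 ps3 \<Rightarrow> 'k ps3 \<Rightarrow> 'k ps3 set" where
  "pideal f g = {u * g + w * f | u w. True}"

definition lead_exps :: "'k::comm_ring_1 ps3 \<Rightarrow> 'k ps3 \<Rightarrow> expo set" where
  "lead_exps f g = {m. \<exists>r. r \<in> pideal f g \<and> r \<in> xdeg_less 2 \<and> is_lead r m}"

lemma pidealI: "u * g + w * f \<in> pideal f g"
  by (auto simp: pideal_def)

lemma pideal_gens: "f \<in> pideal f g" "g \<in> pideal f g"
  using pidealI[of 0 g 1 f] pidealI[of 1 g 0 f] by simp_all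

lemma pideal_add: "a \<in> pideal f g \<Longrightarrow> b \<in> pideal f g \<Longrightarrow> a + b \<in> pideal f g"
proof -
  assume "a \<in> pideal f g" "b \<in> pideal f g"
  then obtain u w u' w' where "a = u * g + w * f" "b = u' * g + w' * f" by (auto simp: pideal_def)
  then have "a + b = (u + u') * g + (w + w') * f" by (simp add: algebra_simps)
  then show ?thesis by (simp add: pidealI)
qed

lemma pideal_mult: "a \<in> pideal f g \<Longrightarrow> r * a \<in> pideal f g"
proof -
  assume "a \<in> pideal f g"
  then obtain u w where "a = u * g + w * f" by (auto simp: pideal_def)
  then have "r * a = (r * u) * g + (r * w) * f" by (simp add: algebra_simps)
  then show ?thesis by (simp add: pidealI)
qed

lemma pideal_diff: "a \<in> pideal f g \<Longrightarrow> b \<in> pideal f g \<Longrightarrow> a - b \<in> pideal f g"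
  using pideal_add[of a f g "- b"] pideal_mult[of b f g "- 1"] by simp

text \<open>Multiplication by a monomial in \<open>y\<close> and \<open>z\<close> preserves both the
  ideal and the bound on the power of \<open>x\<close>.\<close>

lemma lead_exps_shift_yz:
  fixes f g :: "'k::idom ps3"
  assumes "m \<in> lead_exps f g" "n = (0, b, c)"
  shows "n + m \<in> lead_exps f g"
proof -
  obtain r where r: "r \<in> pideal f g" "r \<in> xdeg_less 2" "is_lead r m" using assms by (auto simp: lead_exps_def)
  have "ps_monom n \<in> xdeg_less 1" using assms(2) by (auto simp: xdeg_less_def cf_monom)
  then have "ps_monom n * r \<in> xdeg_less 2" using r(2) xdeg_less_1_mult[of _ r 1] by (simp add: numeral_2_eq_2)
  moreover have "ps_monom n * r \<in> pideal f g" using r(1) by (rule pideal_mult)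
  moreover have "is_lead (ps_monom n * r) (n + m)" using r(3) by (rule is_lead_monom_mult)
  ultimately show ?thesis by (auto simp: lead_exps_def)
qed

lemma lead_exps_xdeg_less: "m \<in> lead_exps f g \<Longrightarrow> fst m < 2"
  by (auto simp: lead_exps_def is_lead_def dest!: xltD)

text \<open>Multiplying by a power series in \<open>y\<close> merely rescales the terms of lowest degree.\<close>

lemma is_lead_combination:
  fixes r :: "nat \<Rightarrow> 'k::idom ps3"
  assumes "finite S" and lm: "\<And>i. i \<in> S \<Longrightarrow> is_lead (r i) (e i)" and inj: "inj_on e S"
    and j: "\<And>i. i \<in> S \<Longrightarrow> tdeg (e i) = j" and ex: "\<exists>i\<in>S. fps_nth (k i) 0 \<noteq> 0"
  shows "\<exists>i\<in>S. is_lead (\<Sum>i\<in>S. ps_of_y (k i) * r i) (e i)"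
proof -
  let ?T = "{i \<in> S. fps_nth (k i) 0 \<noteq> 0}"
  let ?D = "\<Sum>i\<in>S. ps_of_y (k i) * r i"
  have T: "finite ?T" "?T \<noteq> {}" using assms(1) ex by auto
  \<comment> \<open>Among the terms with unit coefficient the one of least key survives: the
    exponents are distinct, and nonunit coefficients push their terms beyond degree
    \<open>j\<close>.\<close>
  define i0 where "i0 = arg_min_on (\<lambda>i. lead_key (e i)) ?T"
  have i0: "i0 \<in> ?T" unfolding i0_def by (rule arg_min_if_finite(1)[OF T])
  have min: "lead_key (e i0) \<le> lead_key (e i)" if "i \<in> ?T" for i
    unfolding i0_def by (rule arg_min_least[OF T that])
  have rge: "r i \<in> ps_ge j" if "i \<in> S" for i
    using lm[OF that] is_lead_ge_iff j[OF that] by blast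
  have cfD: "cf ?D m = (\<Sum>i\<in>S. fps_nth (k i) 0 * cf (r i) m)" if "tdeg m \<le> j" for m
    unfolding cf_sum by (rule sum.cong[OF refl]) (rule cf_ps_of_y_mult[OF rge that])
  have z: "fps_nth (k i) 0 * cf (r i) m = 0"
    if "i \<in> S" "lead_key m \<le> lead_key (e i0)" "i \<noteq> i0 \<or> m \<noteq> e i0" for i m
  proof (cases "i \<in> ?T")
    case True
    have "e i \<noteq> m"
      using that True min[OF True] inj i0 by (metis (mono_tags, lifting) inj_on_def lead_key_inj mem_Collect_eq order_antisym)
    then have "lead_key m \<noteq> lead_key (e i)" using lead_key_inj by blast
    then have "lead_key m < lead_key (e i)" using that(2) min[OF True] by simp
    then show ?thesis using lm[OF that(1)] by (simp add: is_lead_def)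
  qed (use that in auto)
  have "is_lead ?D (e i0)"
    unfolding is_lead_def
  proof (intro conjI allI impI)
    have "cf ?D (e i0) = (\<Sum>i\<in>S. fps_nth (k i) 0 * cf (r i) (e i0))"
      using i0 j by (intro cfD) auto
    also have "\<dots> = (\<Sum>i\<in>{i0}. fps_nth (k i) 0 * cf (r i) (e i0))"
      using assms(1) i0 z by (intro sum.mono_neutral_right) auto
    finally show "cf ?D (e i0) \<noteq> 0" using i0 lm[of i0] by (simp add: is_lead_def)
  next
    fix m' assume l: "lead_key m' < lead_key (e i0)"
    then have "tdeg m' \<le> j" using lead_key_less_deg[OF l] j i0 by auto
    then have "cf ?D m' = (\<Sum>i\<in>S. fps_nth (k i) 0 * cf (r i) m')" by (rule cfD)
    also have "\<dots> = 0"
    proof (rule sum.neutral, rule ballI)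
      fix i assume "i \<in> S"
      moreover have "m' \<noteq> e i0" "lead_key m' \<le> lead_key (e i0)" using l by auto
      ultimately show "fps_nth (k i) 0 * cf (r i) m' = 0" using z by blast
    qed
    finally show "cf ?D m' = 0" .
  qed
  then show ?thesis using i0 by blast
qed

section \<open>Reduction modulo a quadric containing \<open>x^2\<close>\<close>

context
  fixes f g :: "'k::field ps3"
  assumes f2: "f \<in> ps_ge 2" and f200: "cf f (2, 0, 0) \<noteq> 0"
begin

text \<open>The key of \<open>x^2\<close> is \<open>(2, 0, 0)\<close>, the least one in degree two,
  and \<open>f\<close> has no terms of lower degree.\<close>

lemma is_lead_f: "is_lead f (2, 0, 0)"
  unfolding is_lead_def
proof (intro conjI allI impI f200)
  fix m' assume "lead_key m' < lead_key (2, 0, 0)"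
  then have "tdeg m' < 2" by (cases m') auto
  then show "cf f m' = 0" by (rule ps_geD[OF f2])
qed

lemma division_f: "\<exists>q. h - q * f \<in> xdeg_less 2"
  using f2 f200 by (intro ps_division) (auto simp: ps_ge_def)

text \<open>The leading exponent of \<open>r\<close> has \<open>x\<close>-power below two and that
  of \<open>q * f\<close> has \<open>x\<close>-power at least two. They differ, so leading terms
  cannot cancel.\<close>

lemma is_lead_add_multiple:
  assumes r: "r \<in> xdeg_less 2" "is_lead r m" and q: "is_lead q p"
  shows "is_lead (r + q * f) (if lead_key m < lead_key (p + (2, 0, 0)) then m else p + (2, 0, 0))"
    "lead_key m \<noteq> lead_key (p + (2, 0, 0))"
proof -
  have qf: "is_lead (q * f) (p + (2, 0, 0))" by (rule is_lead_mult[OF q is_lead_f])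
  have "fst m < 2" using r by (metis is_lead_def not_less xltD)
  then have "m \<noteq> p + (2, 0, 0)" by auto
  then show ne: "lead_key m \<noteq> lead_key (p + (2, 0, 0))" using lead_key_inj by blast
  show "is_lead (r + q * f) (if lead_key m < lead_key (p + (2, 0, 0)) then m else p + (2, 0, 0))"
    using is_lead_add[OF r(2) qf] is_lead_add[OF qf r(2)] ne by (auto simp: add.commute[of r])
qed

text \<open>A nonzero multiple of \<open>f\<close> has a leading exponent divisible by
  \<open>x^2\<close>. This is the uniqueness of remainders modulo \<open>f\<close>.\<close>

lemma xdeg_less_multiple_eq_0:
  assumes "q * f \<in> xdeg_less 2"
  shows "q * f = 0"
proof (rule ccontr)
  assume "q * f \<noteq> 0"
  then have "q \<noteq> 0" by auto
  then obtain p where "is_lead q p" using is_lead_ex by blast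
  then have "is_lead (q * f) (p + (2, 0, 0))" by (rule is_lead_mult[OF _ is_lead_f])
  then show False using xltD[OF assms, of "p + (2, 0, 0)"] by (simp add: is_lead_def)
qed

lemma ps_ge_no_cancel:
  assumes "r \<in> xdeg_less 2" "r + q * f \<in> ps_ge n"
  shows "r \<in> ps_ge n"
proof (cases "r = 0 \<or> q = 0")
  case False
  then obtain m p where m: "is_lead r m" and p: "is_lead q p" using is_lead_ex by blast
  let ?p = "p + (2, 0, 0)"
  have "n \<le> tdeg (if lead_key m < lead_key ?p then m else ?p)"
    using is_lead_ge_iff[OF is_lead_add_multiple(1)[OF assms(1) m p]] assms(2) by blast
  moreover have "tdeg ?p \<le> tdeg m" if "\<not> lead_key m < lead_key ?p"
    using that is_lead_add_multiple(2)[OF assms(1) m p] by (intro lead_key_less_deg) simp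
  ultimately have "n \<le> tdeg m" by (cases "lead_key m < lead_key ?p") auto
  then show ?thesis using is_lead_ge_iff[OF m] by blast
qed (use assms in auto)

lemma is_lead_no_cancel:
  assumes "r \<in> xdeg_less 2" "is_lead (r + q * f) m" "fst m < 2"
  shows "is_lead r m"
proof (cases "q = 0")
  case False
  then obtain p where p: "is_lead q p" using is_lead_ex by blast
  have "r \<noteq> 0"
  proof
    assume "r = 0"
    then have "m = p + (2, 0, 0)"
      using assms(2) is_lead_unique[OF is_lead_mult[OF p is_lead_f]] by simp
    then show False using assms(3) by simp
  qed
  then obtain m' where m': "is_lead r m'" using is_lead_ex by blast
  have "m = (if lead_key m' < lead_key (p + (2, 0, 0)) then m' else p + (2, 0, 0))"
    using is_lead_unique[OF assms(2) is_lead_add_multiple(1)[OF assms(1) m' p]] .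
  then show ?thesis using m' assms(3) by (auto split: if_splits)
qed (use assms in auto)

text \<open>Reducing an element of the ideal modulo \<open>f\<close> keeps its leading exponent as
  long as the latter is not divisible by \<open>x^2\<close>; hence the elements need not be reduced
  beforehand.\<close>

lemma lead_exps_iff:
  assumes "fst m < 2"
  shows "m \<in> lead_exps f g \<longleftrightarrow> (\<exists>v\<in>pideal f g. is_lead v m)"
proof
  assume "\<exists>v\<in>pideal f g. is_lead v m"
  then obtain v where v: "v \<in> pideal f g" "is_lead v m" by blast
  obtain q where q: "v - q * f \<in> xdeg_less 2" using division_f by blast
  have "is_lead (v - q * f) m"
    by (rule is_lead_no_cancel[OF q _ assms, of q]) (use v in simp)
  moreover have "v - q * f \<in> pideal f g" using v by (intro pideal_diff pideal_mult pideal_gens)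
  ultimately show "m \<in> lead_exps f g" using q by (auto simp: lead_exps_def)
qed (auto simp: lead_exps_def)

text \<open>The product with \<open>x\<close> may fail to be reduced, but its leading exponent still
  has \<open>x\<close>-power one, so \<open>lead_exps_iff\<close> applies.\<close>

lemma lead_exps_shift_x:
  assumes "(0, b, c) \<in> lead_exps f g"
  shows "(1, b, c) \<in> lead_exps f g"
proof -
  obtain r where r: "r \<in> pideal f g" "is_lead r (0, b, c)" using assms by (auto simp: lead_exps_def)
  have "is_lead (ps_monom (1, 0, 0) * r) ((1, 0, 0) + (0, b, c))" using r(2) by (rule is_lead_monom_mult)
  moreover have "ps_monom (1, 0, 0) * r \<in> pideal f g" using r(1) by (rule pideal_mult)
  ultimately show ?thesis using lead_exps_iff[of "(1, b, c)"] by auto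
qed

text \<open>The source of the growth bound by two. Modulo \<open>(f, z)\<close> the multipliers of
  \<open>g\<close> lie in a \<open>K[[y]]\<close>-module of rank two, so a relation with a unit
  coefficient turns three reduced elements into \<open>z\<close> times an element of the
  ideal.\<close>

lemma lead_exps_z_generation:
  fixes e :: "nat \<Rightarrow> expo"
  assumes e: "\<And>i. i < 3 \<Longrightarrow> e i \<in> lead_exps f g" "inj_on e {..<3}" "\<And>i. i < 3 \<Longrightarrow> tdeg (e i) = j"
  shows "\<exists>i<3. \<exists>m\<in>lead_exps f g. e i = (0, 0, 1) + m"
proof -
  have "\<forall>i\<in>{..<3}. \<exists>r. r \<in> pideal f g \<and> r \<in> xdeg_less 2 \<and> is_lead r (e i)"
    using e(1) by (auto simp: lead_exps_def)
  then obtain r where r: "\<And>i. i < 3 \<Longrightarrow> r i \<in> pideal f g" "\<And>i. i < 3 \<Longrightarrow> r i \<in> xdeg_less 2"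
    "\<And>i. i < 3 \<Longrightarrow> is_lead (r i) (e i)" by (metis lessThan_iff)
  have "\<forall>i\<in>{..<3}. \<exists>u w. r i = u * g + w * f" using r(1) by (auto simp: pideal_def)
  then obtain u w where uw: "\<And>i. i < 3 \<Longrightarrow> r i = u i * g + w i * f" by (metis lessThan_iff)
  have "\<forall>i. \<exists>q. u i - q * f \<in> xdeg_less 2" using division_f by blast
  then obtain q where q: "\<And>i. u i - q i * f \<in> xdeg_less 2" by metis
  have "\<forall>i. \<exists>a b t. u i - q i * f = ps_of_y a + ps_of_y b * ps_x + ps_z * t"
    using xdeg_less_2_mod_z[OF q] by blast
  then obtain A B t where ABt: "\<And>i. u i - q i * f = ps_of_y (A i) + ps_of_y (B i) * ps_x + ps_z * t i"
    by metis
  obtain k where k: "\<exists>i<3. fps_nth (k i) 0 \<noteq> 0" "(\<Sum>i<3. k i * A i) = 0" "(\<Sum>i<3. k i * B i) = 0"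
    using fps_relation_pair by blast
  \<comment> \<open>In this combination the parts of the multipliers without \<open>z\<close> cancel
    by the choice of \<open>k\<close>, leaving \<open>z * T * g\<close> modulo
    \<open>f\<close>.\<close>
  define D where "D = (\<Sum>i<3. ps_of_y (k i) * r i)"
  define T where "T = (\<Sum>i<3. ps_of_y (k i) * t i)"
  define Q where "Q = (\<Sum>i<3. ps_of_y (k i) * (q i * g + w i))"
  have sum_y: "(\<Sum>i<(3::nat). ps_of_y (F i)) = ps_of_y (\<Sum>i<3. F i)" for F :: "nat \<Rightarrow> 'k fps"
    by (simp add: eval_nat_numeral ps_of_y_add)
  have "D = (\<Sum>i<3. ps_of_y (k i * A i) * g + ps_of_y (k i * B i) * (ps_x * g)
      + ps_of_y (k i) * t i * (ps_z * g) + ps_of_y (k i) * (q i * g + w i) * f)"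
    unfolding D_def
  proof (rule sum.cong[OF refl])
    fix i :: nat assume "i \<in> {..<3}"
    then have "r i = u i * g + w i * f" using uw by simp
    also have "u i = ps_of_y (A i) + ps_of_y (B i) * ps_x + ps_z * t i + q i * f"
      using ABt[of i] by (simp add: diff_eq_eq)
    finally show "ps_of_y (k i) * r i = ps_of_y (k i * A i) * g + ps_of_y (k i * B i) * (ps_x * g)
      + ps_of_y (k i) * t i * (ps_z * g) + ps_of_y (k i) * (q i * g + w i) * f"
      by (simp add: ps_of_y_mult algebra_simps)
  qed
  also have "\<dots> = ps_of_y (\<Sum>i<3. k i * A i) * g + ps_of_y (\<Sum>i<3. k i * B i) * (ps_x * g)
      + T * (ps_z * g) + Q * f"
    by (simp add: sum.distrib sum_distrib_right[symmetric] sum_y T_def Q_def)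
  also have "\<dots> = ps_z * (T * g) + Q * f"
    by (simp only: k(2,3)) (simp add: mult_ac)
  finally have D: "D = ps_z * (T * g) + Q * f" .
  \<comment> \<open>Once the cofactor of \<open>z\<close> is reduced, \<open>D\<close> and
    \<open>z\<close> times that remainder are two reduced series congruent modulo \<open>f\<close>,
    hence equal.\<close>
  obtain q' where q': "T * g - q' * f \<in> xdeg_less 2" using division_f by blast
  let ?r = "T * g - q' * f"
  have "D \<in> xdeg_less 2"
    unfolding D_def
  proof (rule xdeg_less_sum)
    fix i :: nat assume "i \<in> {..<3}"
    then show "ps_of_y (k i) * r i \<in> xdeg_less 2"
      using r(2)[of i] xdeg_less_1_mult[OF ps_of_y_xdeg_less[of "k i"], of "r i" 1] by (simp add: numeral_2_eq_2)
  qed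
  moreover have "ps_z * ?r \<in> xdeg_less 2"
    using xdeg_less_1_mult[OF xdeg_less_xyz(3), of ?r 1] q' by (simp add: numeral_2_eq_2)
  ultimately have "D - ps_z * ?r \<in> xdeg_less 2" by (rule xdeg_less_diff)
  moreover have Dr: "D - ps_z * ?r = (Q + ps_z * q') * f" by (simp add: D algebra_simps)
  ultimately have "D - ps_z * ?r = 0" using xdeg_less_multiple_eq_0 by simp
  then have Dz: "D = ps_z * ?r" by simp
  \<comment> \<open>The unit coefficient ensures that \<open>D\<close> is nonzero and leads with one
    of the three given exponents.\<close>
  have "\<exists>i\<in>{..<3}. is_lead D (e i)"
    unfolding D_def by (rule is_lead_combination[of _ r e j]) (use r e k in auto)
  then obtain i where i: "i < 3" "is_lead D (e i)" by auto
  have "?r \<noteq> 0" using Dz is_lead_nonzero[OF i(2)] by auto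
  then obtain m where m: "is_lead ?r m" using is_lead_ex by blast
  have "is_lead (ps_monom (0, 0, 1) * ?r) ((0, 0, 1) + m)" using m by (rule is_lead_monom_mult)
  then have "is_lead D ((0, 0, 1) + m)" by (simp add: Dz ps_monom_def)
  then have "e i = (0, 0, 1) + m" using i(2) is_lead_unique by blast
  moreover have "?r \<in> pideal f g" by (intro pideal_diff pideal_mult pideal_gens)
  then have "m \<in> lead_exps f g" using q' m by (auto simp: lead_exps_def)
  ultimately show ?thesis using i(1) by blast
qed

text \<open>Elements of the ideal agree modulo \<open>f\<close> with multiples \<open>u * g\<close>,
  and in degree \<open>b\<close> only the constant term of \<open>u\<close> matters. So every
  reduced element is a scalar multiple of \<open>g\<close> up to degree \<open>b\<close>.\<close>

lemma lead_exps_low_degree: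
  assumes g: "g \<in> ps_ge b" "g \<notin> ps_ge (Suc b)" "g \<in> xdeg_less 2"
  shows "m \<in> lead_exps f g \<Longrightarrow> b \<le> tdeg m" "\<exists>m. {m \<in> lead_exps f g. tdeg m = b} = {m}"
proof -
  have "g \<noteq> 0" using g(2) by auto
  then obtain n where n: "is_lead g n" using is_lead_ex by blast
  have "b \<le> tdeg n" "\<not> Suc b \<le> tdeg n" using g is_lead_ge_iff[OF n] by blast+
  then have nb: "tdeg n = b" by simp
  have ge: "b \<le> tdeg m" if "m \<in> lead_exps f g" for m
  proof -
    obtain r u w where r: "r \<in> xdeg_less 2" "is_lead r m" "r = u * g + w * f"
      using \<open>m \<in> lead_exps f g\<close> by (auto simp: lead_exps_def pideal_def)
    have "r + (- w) * f \<in> ps_ge b" using r(3) g(1) by (simp add: ps_ge_mult_left)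
    then have "r \<in> ps_ge b" by (rule ps_ge_no_cancel[OF r(1)])
    then show ?thesis using is_lead_ge_iff[OF r(2)] by blast
  qed
  then show "m \<in> lead_exps f g \<Longrightarrow> b \<le> tdeg m" .
  have "m = n" if "m \<in> lead_exps f g" "tdeg m = b" for m
  proof -
    obtain r u w where r: "r \<in> xdeg_less 2" "is_lead r m" "r = u * g + w * f"
      using \<open>m \<in> lead_exps f g\<close> by (auto simp: lead_exps_def pideal_def)
    let ?c = "ps_const (cf u (0, 0, 0))"
    have "?c * g \<in> xdeg_less 2" using g(3) by (auto simp: xdeg_less_def)
    with r(1) have x: "r - ?c * g \<in> xdeg_less 2" by (rule xdeg_less_diff)
    \<comment> \<open>Modulo \<open>f\<close> the difference is \<open>(u - ?c) * g\<close> of order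
      above \<open>b\<close>; being reduced, it has that order itself.\<close>
    have "(r - ?c * g) + (- w) * f = (u - ?c) * g" by (simp add: r(3) algebra_simps)
    also have "\<dots> \<in> ps_ge (1 + b)"
      by (rule ps_ge_mult[OF _ g(1)]) (simp only: ps_ge_1_iff cf_diff cf_const simp_thms if_True diff_self)
    finally have "r - ?c * g \<in> ps_ge (1 + b)" by (rule ps_ge_no_cancel[OF x])
    then have eq: "cf r p = cf u (0, 0, 0) * cf g p" if "tdeg p \<le> b" for p
      using that ps_geD[of "r - ?c * g" "1 + b" p] by simp
    have "is_lead g m"
      unfolding is_lead_def
    proof (intro conjI allI impI)
      have nz: "cf r m \<noteq> 0" "cf r m = cf u (0, 0, 0) * cf g m"
        using r(2) eq[of m] \<open>tdeg m = b\<close> by (auto simp: is_lead_def)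
      then show "cf g m \<noteq> 0" by auto
      fix m' assume l: "lead_key m' < lead_key m"
      then have "cf r m' = 0" using r(2) by (simp add: is_lead_def)
      moreover have "tdeg m' \<le> b" using lead_key_less_deg[OF l] \<open>tdeg m = b\<close> by simp
      ultimately show "cf g m' = 0" using eq[of m'] nz by auto
    qed
    then show ?thesis using n is_lead_unique by blast
  qed
  moreover have "n \<in> lead_exps f g" using n g(3) pideal_gens(2)[of g f] by (auto simp: lead_exps_def)
  ultimately show "\<exists>m. {m \<in> lead_exps f g. tdeg m = b} = {m}" using nb by blast
qed

lemma xdeg_less_2_decomp:
  fixes r :: "'k ps3"
  assumes "r \<in> xdeg_less 2"
  shows "\<exists>u v. u \<in> xdeg_less 1 \<and> v \<in> xdeg_less 1 \<and> r = u + v * ps_x"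
proof (intro exI conjI)
  let ?u = "ps_of_cf (\<lambda>(a, b, c). if a = 0 then cf r (0, b, c) else 0)"
  let ?v = "ps_of_cf (\<lambda>(a, b, c). if a = 0 then cf r (1, b, c) else 0)"
  show "?u \<in> xdeg_less 1" "?v \<in> xdeg_less 1" by (auto simp: xdeg_less_def split: prod.splits)
  show "r = ?u + ?v * ps_x"
  proof (rule cf_eqI)
    fix m :: expo
    obtain a b c where m: "m = (a, b, c)" by (cases m)
    have "a = 0 \<or> a = 1 \<or> 2 \<le> a" by arith
    then show "cf r m = cf (?u + ?v * ps_x) m"
      using xltD[OF assms, of m]
      by (auto simp: m mult.commute[of _ ps_x] cf_x_mult)
  qed
qed

lemma xdeg_less_1_decomp_unique:
  fixes u v :: "'k ps3"
  assumes "u \<in> xdeg_less 1" "v \<in> xdeg_less 1" "u + v * ps_x = 0"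
  shows "u = 0" "v = 0"
proof -
  have eq: "cf u (a, b, c) + (if a = 0 then 0 else cf v (a - 1, b, c)) = 0" for a b c
    using arg_cong[OF assms(3), of "\<lambda>h. cf h (a, b, c)"] by (simp add: mult.commute[of v] cf_x_mult)
  have "cf v (a, b, c) = 0" for a b c
    using eq[of "Suc a" b c] xltD[OF assms(1), of "(Suc a, b, c)"] by simp
  then have "cf v m = 0" for m by (cases m) simp
  then show "v = 0" by (intro cf_eqI) simp
  with assms(3) show "u = 0" by simp
qed

text \<open>
  Modulo \<open>f\<close> the series ring is free over \<open>K[[y,z]]\<close> with basis \<open>1, x\<close>; the determinant of
  multiplication by \<open>g\<close> lies in the ideal and is free of \<open>x\<close>.
\<close>

lemma lead_exps_pure:
  assumes g: "g \<in> xdeg_less 2" "g \<noteq> 0" and nzd: "\<And>h. g * h \<in> range (\<lambda>u. u * f) \<Longrightarrow> h \<in> range (\<lambda>u. u * f)"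
  shows "\<exists>b c. (0, b, c) \<in> lead_exps f g"
proof -
  obtain u v where uv: "u \<in> xdeg_less 1" "v \<in> xdeg_less 1" and gdec: "g = u + v * ps_x"
    using xdeg_less_2_decomp[OF g(1)] by blast
  obtain q where q: "ps_x * g - q * f \<in> xdeg_less 2" using division_f by blast
  obtain u' v' where uv': "u' \<in> xdeg_less 1" "v' \<in> xdeg_less 1" and xg: "ps_x * g - q * f = u' + v' * ps_x"
    using xdeg_less_2_decomp[OF q] by blast
  have mult1: "a * b \<in> xdeg_less 1" if "a \<in> xdeg_less 1" "b \<in> xdeg_less 1" for a b :: "'k ps3"
    using xdeg_less_1_mult[of a b 0] that by simp
  have multx: "a * ps_x \<in> xdeg_less 2" if "a \<in> xdeg_less 1" for a :: "'k ps3"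
    using xdeg_less_1_mult[OF that, of ps_x 1] xdeg_less_xyz(1) by (simp add: numeral_2_eq_2)
  have mono12: "a \<in> xdeg_less 2" if "a \<in> xdeg_less 1" for a :: "'k ps3"
    using that by (rule xdeg_less_mono) simp
  \<comment> \<open>The determinant of the matrix with rows \<open>(u, v)\<close> and
    \<open>(u', v')\<close>, which express \<open>g\<close> and \<open>x * g\<close> modulo
    \<open>f\<close> in the basis \<open>1, x\<close>.\<close>
  define D where "D = v' * u - v * u'"
  have x1: "D \<in> xdeg_less 1" unfolding D_def by (intro xdeg_less_diff mult1 uv uv')
  have xg': "ps_x * g = u' + v' * ps_x + q * f" using xg by (simp add: diff_eq_eq)
  have "(v' - v * ps_x) * g = v' * g - v * (ps_x * g)" by (simp add: algebra_simps)
  also have "\<dots> = v' * (u + v * ps_x) - v * (u' + v' * ps_x + q * f)"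
    by (subst xg', subst gdec, rule refl)
  finally have gD: "(v' - v * ps_x) * g = D - (v * q) * f"
    unfolding D_def by (simp add: algebra_simps)
  have "D \<noteq> 0"
  \<comment> \<open>If \<open>D\<close> vanishes, regularity makes \<open>v' - v * ps_x\<close> a
    multiple of \<open>f\<close>. It is reduced, so \<open>v\<close> and \<open>v'\<close> are zero;
    then \<open>u * ps_x\<close> is congruent to \<open>u'\<close>, which forces \<open>u\<close>
    and with it \<open>g\<close> to be zero.\<close>
  proof
    assume "D = 0"
    then have "(v' - v * ps_x) * g = (- (v * q)) * f" using gD by simp
    then have "g * (v' - v * ps_x) = (- (v * q)) * f" by (subst mult.commute)
    then have "v' - v * ps_x \<in> range (\<lambda>u. u * f)" by (intro nzd[OF range_eqI])
    then obtain w where w: "v' - v * ps_x = w * f" by (rule rangeE)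
    moreover have "v' - v * ps_x \<in> xdeg_less 2" using uv uv' by (intro xdeg_less_diff mono12 multx)
    ultimately have "w * f = 0" by (intro xdeg_less_multiple_eq_0) simp
    with w have "v' - v * ps_x = 0" by simp
    then have "v' + (- v) * ps_x = 0" by simp
    moreover have "- v \<in> xdeg_less 1" using uv(2) by (simp add: xdeg_less_def)
    ultimately have "v' = 0" "- v = 0" using xdeg_less_1_decomp_unique[OF uv'(2)] by blast+
    then have v0: "v = 0" "v' = 0" by auto
    then have "ps_x * u - q * f = u'" using xg gdec by simp
    then have qf: "u * ps_x - u' = q * f" by (simp add: algebra_simps)
    have "u * ps_x - u' \<in> xdeg_less 2" using uv uv' by (intro xdeg_less_diff mono12 multx)
    then have "u * ps_x - u' = 0" using qf xdeg_less_multiple_eq_0 by simp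
    then have "- u' + u * ps_x = 0" by simp
    moreover have "- u' \<in> xdeg_less 1" using uv'(1) by (simp add: xdeg_less_def)
    ultimately have "u = 0" using xdeg_less_1_decomp_unique uv(1) by blast
    then show False using g(2) gdec v0 by simp
  qed
  then obtain m where m: "is_lead D m" using is_lead_ex by blast
  have "fst m < 1" using m x1 by (metis is_lead_def not_less xltD)
  then obtain b c where "m = (0, b, c)" by (cases m) auto
  moreover have "D = (v' - v * ps_x) * g + (v * q) * f" using gD by simp
  then have "D \<in> pideal f g" using pidealI by metis
  ultimately show ?thesis using m mono12[OF x1] by (auto simp: lead_exps_def)
qed

end

section \<open>Counting leading exponents\<close>

text \<open>There are \<open>n + 1\<close> monomials in \<open>y, z\<close> of degree
  \<open>n\<close>, and \<open>n\<close> further ones with a single factor \<open>x\<close>.\<close>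

lemma card_tdeg_fst: "finite {m. tdeg m = n \<and> fst m < 2}" "card {m. tdeg m = n \<and> fst m < 2} = 2 * n + 1"
proof -
  show fin: "finite {m. tdeg m = n \<and> fst m < 2}"
    by (rule finite_subset[OF _ finite_tdeg_eq[of n]]) auto
  let ?A = "(\<lambda>i. (0, i, n - i)) ` {..n} :: expo set" and ?B = "(\<lambda>i. (1, i, n - 1 - i)) ` {..<n} :: expo set"
  have "{m. tdeg m = n \<and> fst m < 2} = ?A \<union> ?B"
  proof
    show "{m. tdeg m = n \<and> fst m < 2} \<subseteq> ?A \<union> ?B"
    proof
      fix m assume m: "m \<in> {m. tdeg m = n \<and> fst m < 2}"
      obtain a i c where aic: "m = (a, i, c)" by (cases m)
      have "a = 0 \<or> a = 1" using m by (auto simp: aic)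
      then show "m \<in> ?A \<union> ?B" using m by (auto simp: aic image_iff)
    qed
  qed auto
  moreover have "card (?A \<union> ?B) = card ?A + card ?B"
    by (rule card_Un_disjoint) auto
  moreover have "card ?A = n + 1" "card ?B = n"
    by (subst card_image; auto simp: inj_on_def)+
  ultimately show "card {m. tdeg m = n \<and> fst m < 2} = 2 * n + 1" by simp
qed

text \<open>The numerical core of the bound on flats: from \<open>b\<close> on, \<open>H\<close>
  gains one except at stationary steps, while before its final value is reached it must exceed its
  argument.\<close>

lemma flat_bound:
  fixes H :: "nat \<Rightarrow> nat"
  assumes b: "2 \<le> b"
    and low: "\<And>j. j < b \<Longrightarrow> H j = 2 * j + 1" and at_b: "H b = 2 * b"
    and step: "\<And>n. b \<le> n \<Longrightarrow> H (Suc n) = H n \<or> H (Suc n) = Suc (H n)"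
    and small: "\<And>n. b \<le> n \<Longrightarrow> H n \<le> n \<Longrightarrow> H (Suc n) = H n"
    and ev: "\<And>n. N \<le> n \<Longrightarrow> H (Suc n) = H n"
  shows "finite {n. flat_at H n}" "card {n. flat_at H n} \<le> b - 1"
proof -
  define e where "e = H N"
  have const: "H n = e" if "N \<le> n" for n
    using that by (induction n rule: dec_induct) (auto simp: e_def ev)
  have mult: "hf_multiplicity H = e"
    unfolding hf_multiplicity_def
  proof (rule the_equality)
    show "\<exists>N. \<forall>t\<ge>N. H t = e" using const by blast
    fix e' assume "\<exists>N. \<forall>t\<ge>N. H t = e'"
    then obtain N' where "\<forall>t\<ge>N'. H t = e'" by blast
    then have "H (max N N') = e'" by simp
    then show "e' = e" using const[of "max N N'"] by simp
  qed
  let ?F = "{n. flat_at H n}"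
  have F: "b \<le> n" "H (Suc n) = H n" "H n < e" if "n \<in> ?F" for n
  proof -
    show eq: "H (Suc n) = H n" and "H n < e" using that mult by (auto simp: flat_at_def)
    show "b \<le> n"
    proof (rule ccontr)
      assume "\<not> b \<le> n"
      then consider "Suc n < b" | "Suc n = b" by linarith
      then show False
      proof cases
        case 1
        then show ?thesis using low[of n] low[of "Suc n"] eq by simp
      next
        case 2
        then show ?thesis using low[of n] at_b eq by simp
      qed
    qed
  qed
  \<comment> \<open>Once \<open>H n \<le> n\<close>, the assumption \<open>small\<close> keeps
    \<open>H\<close> constant from \<open>n\<close> on, so \<open>H n\<close> would already be the
    multiplicity.\<close>
  have large: "n < H n" if "b \<le> n" "H n < e" for n
  proof (rule ccontr)
    assume "\<not> n < H n"
    have "H m = H n \<and> H m \<le> m" if "n \<le> m" for m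
      using that
    proof (induction m rule: dec_induct)
      case (step m)
      then show ?case using small[of m] \<open>b \<le> n\<close> by simp
    qed (use \<open>\<not> n < H n\<close> in simp)
    from this[of "max n N"] show False using const[of "max n N"] that(2) by simp
  qed
  have "?F \<subseteq> {..<e}"
  proof
    fix n assume "n \<in> ?F"
    from F[OF this] large[of n] show "n \<in> {..<e}" by simp
  qed
  then show fin: "finite ?F" by (rule finite_subset) simp
  have count: "H n + card {k \<in> {b..<n}. H (Suc k) = H k} = b + n" if "b \<le> n" for n
    using that
  proof (induction n rule: dec_induct)
    case base
    then show ?case by (simp add: at_b)
  next
    case (step n)
    let ?C = "\<lambda>n. {k \<in> {b..<n}. H (Suc k) = H k}"
    show ?case
    proof (cases "H (Suc n) = H n")
      case True
      then have "?C (Suc n) = insert n (?C n)" using step.hyps by auto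
      then have "card (?C (Suc n)) = Suc (card (?C n))" by simp
      then show ?thesis using step.IH True by simp
    next
      case False
      then have "?C (Suc n) = ?C n" by (auto simp: less_Suc_eq)
      moreover have "H (Suc n) = Suc (H n)" using False assms(4)[of n] step.hyps by simp
      ultimately show ?thesis using step.IH by simp
    qed
  qed
  show "card ?F \<le> b - 1"
  proof (cases "?F = {}")
    case False
    define M where "M = Max ?F"
    have M: "M \<in> ?F" unfolding M_def using fin False by (rule Max_in)
    note FM = F[OF M]
    have "?F \<subseteq> {k \<in> {b..<Suc M}. H (Suc k) = H k}"
      using F Max_ge[OF fin] by (auto simp: M_def less_Suc_eq_le)
    then have "card ?F \<le> card {k \<in> {b..<Suc M}. H (Suc k) = H k}" by (intro card_mono) auto
    \<comment> \<open>\<open>H\<close> has the same value below \<open>e\<close> at \<open>M\<close>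
      and at \<open>Suc M\<close>, so the strict bound may be used one place further; this gives
      \<open>b - 1\<close> instead of \<open>b\<close>.\<close>
    moreover have "Suc M < H (Suc M)" using FM by (intro large) auto
    ultimately show ?thesis using count[of "Suc M"] FM(1) by linarith
  qed (metis card.empty zero_le)
qed

section \<open>Combinatorics of a staircase of leading exponents\<close>

locale staircase =
  fixes L :: "expo set" and b :: nat
  assumes fst_less: "m \<in> L \<Longrightarrow> fst m < 2"
    and shift_yz: "m \<in> L \<Longrightarrow> (0, i, k) + m \<in> L"
    and shift_x: "(0, i, k) \<in> L \<Longrightarrow> (1, i, k) \<in> L"
    and tdeg_ge: "m \<in> L \<Longrightarrow> b \<le> tdeg m"
    and initial: "\<exists>m. {m \<in> L. tdeg m = b} = {m}"
    and z_generation: "\<lbrakk>\<And>i::nat. i < 3 \<Longrightarrow> e i \<in> L; inj_on e {..<3}; \<And>i. i < 3 \<Longrightarrow> tdeg (e i) = j\<rbrakk>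
      \<Longrightarrow> \<exists>i<3. \<exists>m\<in>L. e i = (0, 0, 1) + m"
    and pure: "\<exists>i k. (0, i, k) \<in> L"
    and b_ge: "2 \<le> b"
begin

definition layer :: "nat \<Rightarrow> expo set" where "layer n = {m \<in> L. tdeg m = n}"

lemma finite_layer [simp]: "finite (layer n)"
  unfolding layer_def by (rule finite_subset[OF _ finite_tdeg_eq[of n]]) auto

abbreviation "sy \<equiv> (+) ((0, 1, 0) :: expo)"
abbreviation "sz \<equiv> (+) ((0, 0, 1) :: expo)"

lemma inj_shift: "inj_on ((+) (p::expo)) S"
  by (simp add: inj_on_def expo_add_cancel)

lemma card_shift: "card ((+) (p::expo) ` S) = card S"
  by (rule card_image[OF inj_shift])

lemma layer_shift: "m \<in> layer n \<Longrightarrow> sy m \<in> layer (Suc n)" "m \<in> layer n \<Longrightarrow> sz m \<in> layer (Suc n)"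
  using shift_yz by (auto simp: layer_def tdeg_add)

lemma layer_below_b: "n < b \<Longrightarrow> layer n = {}"
  using tdeg_ge by (fastforce simp: layer_def)

lemma card_layer_b: "card (layer b) = 1"
  using initial by (auto simp: layer_def)

lemma layer_nonempty: "b \<le> n \<Longrightarrow> layer n \<noteq> {}"
proof (induction n rule: dec_induct)
  case base
  then show ?case using card_layer_b by auto
next
  case (step n)
  then show ?case using layer_shift by blast
qed

text \<open>The \<open>z\<close>-shift of the layer embeds it in the next one. The
  \<open>y\<close>-shift of an element with least \<open>z\<close>-exponent is new, because every
  \<open>z\<close>-shift has a larger \<open>z\<close>-exponent.\<close>

lemma card_layer_Suc_ge:
  assumes "b \<le> n"
  shows "Suc (card (layer n)) \<le> card (layer (Suc n))"
proof -
  define m where "m = arg_min_on (\<lambda>m. snd (snd m)) (layer n)"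
  have m: "m \<in> layer n"
    unfolding m_def using layer_nonempty[OF assms] by (intro arg_min_if_finite(1)) auto
  have min: "snd (snd m) \<le> snd (snd m')" if "m' \<in> layer n" for m'
    unfolding m_def using that layer_nonempty[OF assms] by (intro arg_min_least) auto
  have "sy m \<notin> sz ` layer n"
  proof
    assume "sy m \<in> sz ` layer n"
    then obtain m' where m': "m' \<in> layer n" "sy m = sz m'" by blast
    have "snd (snd (sy m)) = snd (snd (sz m'))" using m'(2) by (rule arg_cong)
    then show False using min[OF m'(1)] by simp
  qed
  then have "card (insert (sy m) (sz ` layer n)) = Suc (card (layer n))"
    by (simp add: card_shift)
  moreover have "insert (sy m) (sz ` layer n) \<subseteq> layer (Suc n)" using m layer_shift by blast
  ultimately show ?thesis by (metis card_mono finite_layer)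
qed

text \<open>Three exponents outside the \<open>z\<close>-shift of the previous layer would
  contradict \<open>z_generation\<close>.\<close>

lemma card_layer_Suc_le: "card (layer (Suc n)) \<le> card (layer n) + 2"
proof (rule ccontr)
  assume "\<not> card (layer (Suc n)) \<le> card (layer n) + 2"
  then have "3 \<le> card (layer (Suc n)) - card (sz ` layer n)" by (simp add: card_shift)
  also have "\<dots> \<le> card (layer (Suc n) - sz ` layer n)"
    by (rule diff_card_le_card_Diff) simp
  finally obtain T where T: "T \<subseteq> layer (Suc n) - sz ` layer n" "card T = 3" "finite T"
    by (rule obtain_subset_with_card_n)
  obtain e where e: "bij_betw e {0..<card T} T" using ex_bij_betw_nat_finite[OF T(3)] by blast
  then have "inj_on e {..<3}" and eT: "\<And>i. i < 3 \<Longrightarrow> e i \<in> T"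
    using T(2) by (auto simp: bij_betw_def lessThan_atLeast0)
  moreover have "e i \<in> L" "tdeg (e i) = Suc n" if "i < 3" for i
    using eT[OF that] T(1) by (auto simp: layer_def)
  ultimately obtain i m where i: "i < 3" "m \<in> L" "e i = sz m" using z_generation[of e "Suc n"] by blast
  have "m \<in> layer n"
    using i(2,3) eT[OF i(1)] T(1) by (auto simp: layer_def tdeg_add)
  then show False using i eT[OF i(1)] T(1) by blast
qed

text \<open>The \<open>y\<close>-shifts of exponents with \<open>z\<close>-exponent at most
  \<open>c\<close> and the \<open>z\<close>-shifts of those with \<open>z\<close>-exponent at least
  \<open>c\<close> are disjoint. The two exponents at \<open>c\<close> itself are counted
  twice.\<close>

lemma card_layer_Suc_pair:
  assumes "m1 \<in> layer n" "m2 \<in> layer n" "m1 \<noteq> m2" "snd (snd m1) = c" "snd (snd m2) = c"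
  shows "card (layer n) + 2 \<le> card (layer (Suc n))"
proof -
  let ?A = "{m \<in> layer n. snd (snd m) \<le> c}" and ?B = "{m \<in> layer n. c \<le> snd (snd m)}"
  have "{m1, m2} \<subseteq> ?A \<inter> ?B" using assms by auto
  then have "card {m1, m2} \<le> card (?A \<inter> ?B)" by (intro card_mono) auto
  then have int: "2 \<le> card (?A \<inter> ?B)" using assms(3) by simp
  have "?A \<union> ?B = layer n" by auto
  then have un_int: "card ?A + card ?B = card (layer n) + card (?A \<inter> ?B)"
    using card_Un_Int[of ?A ?B] by simp
  have "sy ` ?A \<inter> sz ` ?B = {}"
  proof (rule ccontr)
    assume "sy ` ?A \<inter> sz ` ?B \<noteq> {}"
    then obtain p q where pq: "p \<in> ?A" "q \<in> ?B" "sy p = sz q" by blast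
    have "snd (snd (sy p)) = snd (snd (sz q))" using pq(3) by (rule arg_cong)
    then show False using pq(1,2) by auto
  qed
  then have "card (sy ` ?A \<union> sz ` ?B) = card ?A + card ?B"
    by (subst card_Un_disjoint) (auto simp: card_shift)
  moreover have "card (sy ` ?A \<union> sz ` ?B) \<le> card (layer (Suc n))"
    by (rule card_mono[OF finite_layer]) (use layer_shift in blast)
  ultimately show ?thesis using int un_int by linarith
qed

text \<open>Either two exponents share their \<open>z\<close>-exponent, or all values from
  \<open>0\<close> to \<open>n\<close> occur. In the latter case \<open>z^n\<close> lies in the
  layer, and \<open>x * z^n\<close> and \<open>z^(n+1)\<close> are not among the
  \<open>y\<close>-shifts because they contain no \<open>y\<close>.\<close>

lemma card_layer_Suc_large:
  assumes "Suc n \<le> card (layer n)"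
  shows "card (layer n) + 2 \<le> card (layer (Suc n))"
proof (cases "inj_on (\<lambda>m. snd (snd m)) (layer n)")
  case False
  then obtain m1 m2 where "m1 \<in> layer n" "m2 \<in> layer n" "m1 \<noteq> m2" "snd (snd m1) = snd (snd m2)"
    unfolding inj_on_def by blast
  then show ?thesis by (intro card_layer_Suc_pair[of m1 n m2]) auto
next
  case True
  have sub: "(\<lambda>m. snd (snd m)) ` layer n \<subseteq> {..n}"
  proof (rule image_subsetI)
    fix m assume "m \<in> layer n"
    then show "snd (snd m) \<in> {..n}" by (cases m) (auto simp: layer_def)
  qed
  have "card ((\<lambda>m. snd (snd m)) ` layer n) = card (layer n)" by (rule card_image[OF True])
  then have "(\<lambda>m. snd (snd m)) ` layer n = {..n}"
    using assms by (intro card_seteq sub) auto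
  then obtain m where m: "m \<in> layer n" "snd (snd m) = n" by (metis (no_types, lifting) atMost_iff imageE order_refl)
  obtain a i c where "m = (a, i, c)" by (cases m)
  then have "m = (0, 0, n)" using m by (auto simp: layer_def)
  then have L: "(0, 0, n) \<in> L" using m by (simp add: layer_def)
  have "(0, 0, Suc n) \<in> L" using shift_yz[OF L, of 0 1] by simp
  then have "{(1, 0, n), (0, 0, Suc n)} \<union> sy ` layer n \<subseteq> layer (Suc n)"
    using shift_x[OF L] layer_shift by (auto simp: layer_def)
  then have "card ({(1, 0, n), (0, 0, Suc n)} \<union> sy ` layer n) \<le> card (layer (Suc n))"
    by (intro card_mono) auto
  moreover have "card ({(1, 0, n), (0, 0, Suc n)} \<union> sy ` layer n) = 2 + card (layer n)"
  proof (subst card_Un_disjoint)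
    show "{(1, 0, n), (0, 0, Suc n)} \<inter> sy ` layer n = {}"
    proof (rule ccontr)
      assume "{(1, 0, n), (0, 0, Suc n)} \<inter> sy ` layer n \<noteq> {}"
      then obtain p where "sy p = (1, 0, n) \<or> sy p = (0, 0, Suc n)" by auto
      then show False by (cases p) auto
    qed
  qed (auto simp: card_shift)
  ultimately show ?thesis by simp
qed

text \<open>From a pure exponent \<open>(0, i, k)\<close> and its \<open>x\<close>-shift,
  multiplication by powers of \<open>y\<close> reaches two exponents with \<open>z\<close>-exponent
  \<open>k\<close> in every large degree.\<close>

lemma card_layer_Suc_eventually: "\<exists>N. \<forall>n\<ge>N. card (layer n) + 2 \<le> card (layer (Suc n))"
proof -
  obtain i k where ik: "(0, i, k) \<in> L" using pure by blast
  have "card (layer n) + 2 \<le> card (layer (Suc n))" if n: "i + k + 1 \<le> n" for n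
  proof (rule card_layer_Suc_pair)
    have "(0, n - (i + k), 0) + (0, i, k) \<in> L" by (rule shift_yz[OF ik])
    then show "(0, n - k, k) \<in> layer n" using n by (simp add: layer_def)
    have "(0, n - (i + k + 1), 0) + (1, i, k) \<in> L" by (rule shift_yz[OF shift_x[OF ik]])
    then show "(1, n - k - 1, k) \<in> layer n" using n by (simp add: layer_def)
  qed auto
  then show ?thesis by blast
qed

text \<open>In degree \<open>n\<close> the value of \<open>H\<close> and the size of the layer add
  up to \<open>2 * n + 1\<close>. Growth of the layer by one or two thus means growth of
  \<open>H\<close> by one or zero.\<close>

theorem hilbert_staircase:
  assumes H: "\<And>n. H n = card {m. tdeg m = n \<and> fst m < 2 \<and> m \<notin> L}"
  shows "(\<forall>j < b. H j = 2 * j + 1) \<and> H b = 2 * b \<and>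
         (\<forall>j \<ge> b. H (j - 1) \<le> H j \<and> H j \<le> H (j - 1) + 1) \<and>
         finite {n. flat_at H n} \<and> card {n. flat_at H n} \<le> b - 1"
proof -
  have sum: "H n + card (layer n) = 2 * n + 1" for n
  proof -
    let ?C = "{m. tdeg m = n \<and> fst m < 2 \<and> m \<notin> L}"
    have "{m. tdeg m = n \<and> fst m < 2} = ?C \<union> layer n"
      using fst_less by (auto simp: layer_def)
    moreover have "card (?C \<union> layer n) = card ?C + card (layer n)"
    proof (rule card_Un_disjoint)
      show "finite ?C" by (rule finite_subset[OF _ card_tdeg_fst(1)[of n]]) auto
    qed (auto simp: layer_def[of n, symmetric], auto simp: layer_def)
    ultimately show ?thesis using card_tdeg_fst(2)[of n] H by simp
  qed
  have sum_Suc: "H (Suc n) + card (layer (Suc n)) = 2 * n + 3" for n using sum[of "Suc n"] by simp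
  have low: "H j = 2 * j + 1" if "j < b" for j using sum[of j] layer_below_b[OF that] by simp
  have at_b: "H b = 2 * b" using sum[of b] card_layer_b by simp
  have step: "H (Suc n) = H n \<or> H (Suc n) = Suc (H n)" if "b \<le> n" for n
  proof -
    have "H n \<le> H (Suc n)" "H (Suc n) \<le> Suc (H n)"
      using sum[of n] sum_Suc[of n] card_layer_Suc_ge[OF that] card_layer_Suc_le[of n] by linarith+
    then show ?thesis by linarith
  qed
  have small: "H (Suc n) = H n" if "b \<le> n" "H n \<le> n" for n
    using sum[of n] sum_Suc[of n] card_layer_Suc_large[of n] card_layer_Suc_le[of n] that by linarith
  obtain N where N: "\<And>n. N \<le> n \<Longrightarrow> card (layer n) + 2 \<le> card (layer (Suc n))"
    using card_layer_Suc_eventually by blast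
  have ev: "H (Suc n) = H n" if "N \<le> n" for n
    using sum[of n] sum_Suc[of n] N[OF that] card_layer_Suc_le[of n] by linarith
  have "H (j - 1) \<le> H j \<and> H j \<le> H (j - 1) + 1" if "b \<le> j" for j
  proof (cases "j = b")
    \<comment> \<open>The previous value comes from the initial range,
      \<open>2 * (b - 1) + 1\<close>, which is one less than \<open>2 * b\<close>.\<close>
    case True
    have "H (b - 1) + 1 = 2 * b" using low[of "b - 1"] b_ge by simp
    then show ?thesis using at_b True by simp
  next
    case False
    then have "b \<le> j - 1" "Suc (j - 1) = j" using that b_ge by linarith+
    then show ?thesis using step[of "j - 1"] by auto
  qed
  with low at_b flat_bound[OF b_ge low at_b step small ev] show ?thesis by blast
qed

end

section \<open>Initial forms and standard monomials\<close>

definition pmonom :: "'k::comm_ring_1 \<Rightarrow> expo \<Rightarrow> 'k poly3" where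
  "pmonom c = (\<lambda>(i, j, k). poly3_monom c i j k)"

lemma pmonom_mult: "pmonom c p * pmonom d q = pmonom (c * d) (p + q)"
  by (cases p; cases q) (simp add: pmonom_def poly3_monom_def mult_monom)

lemma pmonom_sum: "pmonom (sum F A) p = (\<Sum>x\<in>A. pmonom (F x) p)"
proof (cases p)
  case (fields i j k)
  have "poly3_monom 0 i j k = (0 :: 'a poly3)"
    "poly3_monom (c + d) i j k = poly3_monom c i j k + poly3_monom d i j k" for c d :: 'a
    by (simp_all add: poly3_monom_def add_monom)
  then show ?thesis
    by (induction A rule: infinite_finite_induct) (simp_all add: fields pmonom_def)
qed

lemma initial_form_eq: "initial_form f = (\<Sum>p | tdeg p = ps_order f. pmonom (cf f p) p)"
proof -
  have "{(i, j, k). i + j + k = ps_order f} = {p. tdeg p = ps_order f}"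
    by (auto simp: tdeg_def)
  then show ?thesis
    unfolding initial_form_def by (simp add: pmonom_def cf_def case_prod_beta')
qed

lemma ps_order_ge:
  assumes "f \<noteq> 0"
  shows "f \<in> ps_ge (ps_order f)" "f \<notin> ps_ge (Suc (ps_order f))"
proof -
  let ?P = "\<lambda>v. \<exists>i j k. i + j + k = v \<and> ps_coeff f i j k \<noteq> 0"
  show "f \<in> ps_ge (ps_order f)"
  proof (rule ps_geI)
    fix m assume m: "tdeg m < ps_order f"
    obtain i j k where ijk: "m = (i, j, k)" by (cases m)
    have "\<not> ?P (tdeg m)" using m unfolding ps_order_def by (rule not_less_Least)
    then have "ps_coeff f i j k = 0" unfolding ijk tdeg_triple by blast
    then show "cf f m = 0" by (simp add: ijk cf_def)
  qed
  obtain m where "cf f m \<noteq> 0" using cf_nonzero[OF assms] by blast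
  then have "?P (tdeg m)" by (cases m) (auto simp: cf_def)
  then have "?P (ps_order f)" unfolding ps_order_def by (rule LeastI)
  then obtain i j k where ijk: "i + j + k = ps_order f" "ps_coeff f i j k \<noteq> 0" by blast
  show "f \<notin> ps_ge (Suc (ps_order f))"
  proof
    assume "f \<in> ps_ge (Suc (ps_order f))"
    then have "cf f (i, j, k) = 0" by (rule ps_geD) (simp add: ijk(1))
    then show False using ijk(2) by (simp add: cf_def)
  qed
qed

text \<open>If \<open>g\<close> agrees with \<open>u * f\<close> through its own order, comparing
  lowest degree terms writes its initial form as a form of degree
  \<open>ps_order g - ps_order f\<close> times that of \<open>f\<close>. This is how the condition
  on initial forms enters.\<close>

lemma initial_form_in_ideal:
  fixes f g u :: "'k::idom ps3"
  assumes f: "f \<noteq> 0" and le: "ps_order f \<le> ps_order g" and g: "g \<noteq> 0"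
    and ug: "g - u * f \<in> ps_ge (Suc (ps_order g))"
  shows "initial_form g \<in> Idl\<^bsub>poly_ring\<^esub> {initial_form f}"
proof -
  let ?a = "ps_order f" and ?b = "ps_order g"
  let ?A = "{q. tdeg q = ?a}" and ?C = "{p. tdeg p = ?b - ?a}"
  \<comment> \<open>The product has order at least \<open>?b\<close> and \<open>f\<close> has order
    exactly \<open>?a\<close>, so \<open>u\<close> has no terms of degree below
    \<open>?b - ?a\<close>.\<close>
  have "u * f = g - (g - u * f)" by simp
  also have "\<dots> \<in> ps_ge ?b" by (rule ps_ge_diff[OF ps_order_ge(1)[OF g] ps_ge_mono[OF ug]]) simp
  finally have "u * f \<in> ps_ge ((?b - ?a) + ?a)" using le by simp
  then have u: "u \<in> ps_ge (?b - ?a)" by (rule ps_ge_mult_cancel[OF _ ps_order_ge(2)[OF f]])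
  have "initial_form g = (\<Sum>r | tdeg r = ?b. pmonom (cf (u * f) r) r)"
    unfolding initial_form_eq
  proof (rule sum.cong[OF refl])
    fix r assume "r \<in> {r. tdeg r = ?b}"
    then have "cf g r = cf (u * f) r" using ps_geD[OF ug, of r] by simp
    then show "pmonom (cf g r) r = pmonom (cf (u * f) r) r" by simp
  qed
  also have "\<dots> = (\<Sum>r | tdeg r = ?b. \<Sum>(p, q) | p + q = r. pmonom (cf u p * cf f q) (p + q))"
  proof (rule sum.cong[OF refl])
    fix r
    have "pmonom (cf (u * f) r) r = (\<Sum>t | fst t + snd t = r. pmonom (cf u (fst t) * cf f (snd t)) r)"
      unfolding cf_mult by (simp add: pmonom_sum case_prod_beta')
    also have "\<dots> = (\<Sum>t | fst t + snd t = r. pmonom (cf u (fst t) * cf f (snd t)) (fst t + snd t))"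
      by (rule sum.cong) simp_all
    finally show "pmonom (cf (u * f) r) r = (\<Sum>(p, q) | p + q = r. pmonom (cf u p * cf f q) (p + q))"
      by (simp add: case_prod_beta')
  qed
  also have "\<dots> = (\<Sum>(r, (p, q))\<in>Sigma {r. tdeg r = ?b} (\<lambda>r. {(p, q). p + q = r}).
      pmonom (cf u p * cf f q) (p + q))"
    by (subst sum.Sigma) (auto simp: finite_tdeg_eq finite_decomp case_prod_beta)
  also have "\<dots> = (\<Sum>(p, q)\<in>{(p, q). tdeg (p + q) = ?b}. pmonom (cf u p * cf f q) (p + q))"
    by (rule sum.reindex_bij_witness[of _ "\<lambda>(p, q). (p + q, (p, q))" "\<lambda>(r, t). t"]) auto
  also have "\<dots> = (\<Sum>(p, q)\<in>?C \<times> ?A. pmonom (cf u p * cf f q) (p + q))"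
  proof (rule sum.mono_neutral_right)
    have "{(p, q). tdeg (p + q) = ?b} \<subseteq> {p. tdeg p \<le> ?b} \<times> {q. tdeg q \<le> ?b}"
    proof (rule subsetI)
      fix t assume "t \<in> {(p, q). tdeg (p + q) = ?b}"
      then show "t \<in> {p. tdeg p \<le> ?b} \<times> {q. tdeg q \<le> ?b}" by (cases t) (simp add: tdeg_add)
    qed
    then show "finite {(p, q). tdeg (p + q) = ?b}"
      by (rule finite_subset) (simp add: finite_tdeg_le)
    show "?C \<times> ?A \<subseteq> {(p, q). tdeg (p + q) = ?b}" using le by (auto simp: tdeg_add)
    show "\<forall>t\<in>{(p, q). tdeg (p + q) = ?b} - ?C \<times> ?A. (case t of (p, q) \<Rightarrow> pmonom (cf u p * cf f q) (p + q)) = 0"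
    proof
      fix t assume t: "t \<in> {(p, q). tdeg (p + q) = ?b} - ?C \<times> ?A"
      obtain p q where pq: "t = (p, q)" by (cases t)
      have "tdeg p + tdeg q = ?b" "\<not> (tdeg p = ?b - ?a \<and> tdeg q = ?a)"
        using t by (auto simp: pq tdeg_add)
      then have "tdeg p < ?b - ?a \<or> tdeg q < ?a" by arith
      then have "cf u p * cf f q = 0"
        using ps_geD[OF u, of p] ps_geD[OF ps_order_ge(1)[OF f], of q] by auto
      moreover have "pmonom (0 :: 'k) (p + q) = 0" using pmonom_sum[of _ "{}"] by simp
      ultimately show "(case t of (p, q) \<Rightarrow> pmonom (cf u p * cf f q) (p + q)) = 0"
        by (simp only: pq prod.case)
    qed
  qed
  also have "\<dots> = (\<Sum>p\<in>?C. pmonom (cf u p) p) * initial_form f"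
    unfolding initial_form_eq sum_product sum.cartesian_product
    by (intro sum.cong refl) (auto simp: pmonom_mult)
  finally have "initial_form g \<in> range (\<lambda>w. w * initial_form f)" by blast
  then show ?thesis unfolding poly_ring_def genideal_ring_of_type_1 .
qed

lemma is_lead_congruent:
  assumes "is_lead f m" "f - g \<in> ps_ge (Suc (tdeg m))"
  shows "is_lead g m"
proof -
  have "cf g p = cf f p" if "tdeg p \<le> tdeg m" for p
    using ps_geD[OF assms(2), of p] that by simp
  then show ?thesis using assms(1) lead_key_less_deg unfolding is_lead_def by (metis order_refl)
qed

text \<open>The standard monomials of degree \<open>t\<close>, pulled back along
  \<open>\<psi>\<close>, form a basis. A nontrivial relation would make the leading exponent of
  their combination one of the ideal; spanning follows by successive removal of leading
  terms.\<close>

lemma HF_eq_card_lead_exps: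
  fixes I :: "'k::field ps3 set"
  assumes auto: "ps_auto \<phi> \<psi>" and I: "ideal I ps_ring" and I1: "I \<subseteq> ps_ge 1"
    and f: "f \<in> ps_ge 2" "cf f (2, 0, 0) \<noteq> 0" and img: "\<phi> ` I = pideal f g"
  shows "HF I t = card {m. tdeg m = t \<and> fst m < 2 \<and> m \<notin> lead_exps f g}"
proof (rule HF_eq_card[OF I I1])
  have \<phi>: "ps_endo \<phi>" and \<psi>: "ps_endo \<psi>" and inv: "\<psi> (\<phi> h) = h" "\<phi> (\<psi> h) = h" for h
    using auto by (auto simp: ps_auto_def)
  let ?S = "{m. tdeg m = t \<and> fst m < 2 \<and> m \<notin> lead_exps f g}"
  let ?comb = "\<lambda>c. \<Sum>m\<in>?S. ps_const (c m :: 'k) * ps_monom m"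
  show fin: "finite ?S" by (rule finite_subset[OF _ finite_tdeg_eq[of t]]) auto
  show "\<psi> (ps_monom m) \<in> ps_ge t" if "m \<in> ?S" for m
    using that ps_ge_monom[of m] by (intro ps_endoD(4)[OF \<psi>]) simp
  have \<psi>comb: "\<psi> (?comb c) = (\<Sum>m\<in>?S. ps_const (c m) * \<psi> (ps_monom m))" for c
    by (simp add: ps_endo_simps(6)[OF \<psi>] ps_endoD(2,3)[OF \<psi>])
  have cf_comb: "cf (?comb c) m = (if m \<in> ?S then c m else 0)" for c m
    using fin by (simp add: cf_sum cf_monom if_distrib sum.delta cong: if_cong)
  show "\<forall>m\<in>?S. c m = 0"
    if u: "u \<in> I" and c: "(\<Sum>m\<in>?S. ps_const (c m) * \<psi> (ps_monom m)) - u \<in> ps_ge (Suc t)" for c u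
  proof (rule ccontr)
    assume "\<not> (\<forall>m\<in>?S. c m = 0)"
    then obtain m0 where "m0 \<in> ?S" "c m0 \<noteq> 0" by blast
    then have "cf (?comb c) m0 \<noteq> 0" using cf_comb by simp
    then have "?comb c \<noteq> 0" by auto
    then obtain m where m: "is_lead (?comb c) m" using is_lead_ex by blast
    have mS: "m \<in> ?S"
    proof (rule ccontr)
      assume "m \<notin> ?S"
      then have "cf (?comb c) m = 0" by (simp only: cf_comb if_False)
      with m show False by (simp only: is_lead_def simp_thms)
    qed
    have "\<phi> (\<psi> (?comb c) - u) \<in> ps_ge (Suc t)"
      using c unfolding \<psi>comb by (rule ps_endoD(4)[OF \<phi>])
    then have "?comb c - \<phi> u \<in> ps_ge (Suc (tdeg m))"
      using mS by (simp add: ps_endo_simps(4)[OF \<phi>] inv)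
    then have "is_lead (\<phi> u) m" by (rule is_lead_congruent[OF m])
    moreover have "\<phi> u \<in> pideal f g" using u img by blast
    ultimately have "m \<in> lead_exps f g" using lead_exps_iff[OF f] mS by blast
    then show False using mS by blast
  qed
  \<comment> \<open>The measure counts the exponents of degree \<open>t\<close> whose key is at
    least the leading one; removing the leading term decreases it.\<close>
  have reduce: "\<exists>c. \<exists>w\<in>pideal f g. v - ?comb c - w \<in> ps_ge (Suc t)" if "v \<in> ps_ge t" for v
    using that
  proof (induction "card {m'. tdeg m' = t \<and> (\<exists>m''. cf v m'' \<noteq> 0 \<and> lead_key m'' \<le> lead_key m')}" arbitrary: v rule: less_induct)
    case less
    let ?M = "\<lambda>v. {m'. tdeg m' = t \<and> (\<exists>m''. cf v m'' \<noteq> 0 \<and> lead_key m'' \<le> lead_key m')}"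
    show ?case
    proof (cases "v \<in> ps_ge (Suc t)")
      case True
      have "0 \<in> pideal f g" using pideal_diff[OF pideal_gens(1) pideal_gens(1)] by simp
      then show ?thesis using True
        by (intro exI[of _ "\<lambda>_. 0"] bexI[of _ 0]) (simp_all add: ps_const_simps)
    next
      case False
      then have "v \<noteq> 0" by auto
      then obtain m where m: "is_lead v m" using is_lead_ex by blast
      have tm: "tdeg m = t" using is_lead_ge_iff[OF m] less.prems False by (metis not_less_eq_eq order_antisym)
      have step: "\<exists>c. \<exists>w\<in>pideal f g. (v - ps_const d * p) - ?comb c - w \<in> ps_ge (Suc t)"
        if p: "is_lead p m" and d: "d = cf v m / cf p m" for p d
      proof (rule less.hyps)
        let ?v = "v - ps_const d * p"
        have v0: "cf ?v m' = 0" if "lead_key m' \<le> lead_key m" for m'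
        proof (cases "m' = m")
          case False
          then have "lead_key m' < lead_key m" using that lead_key_inj by (metis order_le_less)
          then show ?thesis using m p by (simp add: is_lead_def)
        qed (use p d in \<open>simp add: is_lead_def\<close>)
        then show "?v \<in> ps_ge t" using lead_key_deg_less tm by (intro ps_geI) fastforce
        show "card (?M ?v) < card (?M v)"
        proof (rule psubset_card_mono)
          show "finite (?M v)" by (rule finite_subset[OF _ finite_tdeg_eq[of t]]) auto
          have "m \<in> ?M v" using m tm by (auto simp: is_lead_def)
          moreover have "m \<notin> ?M ?v" using v0 by blast
          moreover have "m' \<in> ?M v" if m': "m' \<in> ?M ?v" for m'
          proof -
            obtain m'' where m'': "cf ?v m'' \<noteq> 0" "lead_key m'' \<le> lead_key m'" using m' by blast
            then have "lead_key m < lead_key m''" using v0 not_less by blast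
            then have "lead_key m \<le> lead_key m'" using m''(2) by simp
            then show ?thesis using m' m by (auto simp: is_lead_def)
          qed
          ultimately show "?M ?v \<subset> ?M v" by blast
        qed
      qed
      show ?thesis
      proof (cases "m \<in> ?S")
        case True
        have "is_lead (ps_monom m :: 'k ps3) m" by (auto simp: is_lead_def cf_monom)
        then obtain c w where cw: "w \<in> pideal f g"
          "(v - ps_const (cf v m / cf (ps_monom m) m) * ps_monom m) - ?comb c - w \<in> ps_ge (Suc t)"
          using step[OF _ refl] by blast
        define d where "d = cf v m / cf (ps_monom m) m"
        have "?comb (c(m := c m + d)) = ?comb c + ps_const d * ps_monom m"
        proof (rule cf_eqI)
          fix p
          show "cf (?comb (c(m := c m + d))) p = cf (?comb c + ps_const d * ps_monom m) p"
            unfolding cf_add cf_comb cf_const_mult cf_monom using True by simp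
        qed
        then have "v - ?comb (c(m := c m + d)) - w = (v - ps_const d * ps_monom m) - ?comb c - w"
          by simp
        then have "v - ?comb (c(m := c m + d)) - w \<in> ps_ge (Suc t)"
          using cw(2) by (simp only: d_def)
        with cw(1) show ?thesis by blast
      next
        case False
        \<comment> \<open>A nonstandard exponent is led by an element of the ideal: by definition if
          its \<open>x\<close>-power is below two, and otherwise by a monomial multiple of
          \<open>f\<close>.\<close>
        have "\<exists>p\<in>pideal f g. is_lead p m"
        proof (cases "fst m < 2")
          case True
          then show ?thesis using False tm lead_exps_iff[OF f] by blast
        next
          case False
          obtain a i k where aik: "m = (a, i, k)" by (cases m)
          have "is_lead (ps_monom (a - 2, i, k) * f) ((a - 2, i, k) + (2, 0, 0))"
            by (rule is_lead_monom_mult[OF is_lead_f[OF f]])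
          moreover have "(a - 2, i, k) + (2, 0, 0) = m" using False by (simp add: aik)
          moreover have "ps_monom (a - 2, i, k) * f \<in> pideal f g" by (intro pideal_mult pideal_gens)
          ultimately show ?thesis by metis
        qed
        then obtain p where p: "p \<in> pideal f g" "is_lead p m" by blast
        let ?d = "ps_const (cf v m / cf p m)"
        obtain c w where cw: "w \<in> pideal f g" "(v - ?d * p) - ?comb c - w \<in> ps_ge (Suc t)"
          using step[OF p(2) refl] by blast
        have "v - ?comb c - (?d * p + w) = (v - ?d * p) - ?comb c - w" by (simp add: algebra_simps)
        then have "v - ?comb c - (?d * p + w) \<in> ps_ge (Suc t)" using cw(2) by (simp only:)
        moreover have "?d * p + w \<in> pideal f g" using p cw by (intro pideal_add pideal_mult)
        ultimately show ?thesis by blast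
      qed
    qed
  qed
  show "\<exists>c. \<exists>u\<in>I. v - (\<Sum>m\<in>?S. ps_const (c m) * \<psi> (ps_monom m)) - u \<in> ps_ge (Suc t)"
    if v: "v \<in> ps_ge t" for v
  proof -
    have "\<phi> v \<in> ps_ge t" using v by (rule ps_endoD(4)[OF \<phi>])
    then obtain c w where w: "w \<in> pideal f g" "\<phi> v - ?comb c - w \<in> ps_ge (Suc t)"
      using reduce by blast
    then obtain u where u: "u \<in> I" "w = \<phi> u" using img by blast
    have "\<psi> (\<phi> v - ?comb c - w) \<in> ps_ge (Suc t)" using w(2) by (rule ps_endoD(4)[OF \<psi>])
    then have "v - \<psi> (?comb c) - u \<in> ps_ge (Suc t)"
      by (simp only: ps_endo_simps(4)[OF \<psi>] inv u(2))
    then show ?thesis using u(1) unfolding \<psi>comb by blast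
  qed
qed

section \<open>Normalisation of the generators and passage to the staircase\<close>

theorem proposition2p2:
  fixes I :: "'k::{alg_closed_field, field_char_0} ps3 set" and b :: nat
  assumes "2 \<le> b"
    and "ideal_of_type 2 b I"
  shows "(\<forall>j < b. HF I j = 2 * j + 1) \<and>
         HF I b = 2 * b \<and>
         (\<forall>j \<ge> b. HF I (j - 1) \<le> HF I j \<and> HF I j \<le> HF I (j - 1) + 1) \<and>
         finite {n. flat_at (HF I) n} \<and> card {n. flat_at (HF I) n} \<le> b - 1"
proof -
  obtain f g :: "'k ps3" where Idl: "I = Idl\<^bsub>ps_ring\<^esub> {f, g}" and reg: "regular_sequence ps_ring [f, g]"
    and f0: "f \<noteq> 0" and g0: "g \<noteq> 0" and of: "ps_order f = 2" and og: "ps_order g = b"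
    and init: "initial_form g \<notin> Idl\<^bsub>poly_ring\<^esub> {initial_form f}"
    using assms(2) unfolding ideal_of_type_def by blast
  interpret R: ring "ps_ring :: 'k ps3 ring" unfolding ps_ring_def by (rule ring_from_type_algebra)
  have I: "ideal I ps_ring" unfolding Idl by (rule R.genideal_ideal) (simp add: ps_ring_def)
  have I_eq: "I = pideal f g" unfolding Idl ps_ring_def genideal_ring_of_type_2 pideal_def ..
  have f2: "f \<in> ps_ge 2" and f3: "f \<notin> ps_ge 3" using ps_order_ge[OF f0] of by (simp_all add: numeral_3_eq_3 numeral_2_eq_2)
  have gb: "g \<in> ps_ge b" using ps_order_ge(1)[OF g0] og by simp
  have "f \<in> ps_ge 1" "g \<in> ps_ge 1" using ps_ge_mono[OF f2] ps_ge_mono[OF gb] assms(1) by auto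
  then have I1: "I \<subseteq> ps_ge 1" unfolding I_eq pideal_def by (auto intro!: ps_ge_add ps_ge_mult_left)
  have nzd: "h \<in> range (\<lambda>u. u * f)" if "g * h \<in> range (\<lambda>u. u * f)" for h
  proof -
    have "\<forall>h \<in> carrier ps_ring. [f, g] ! 1 \<otimes>\<^bsub>ps_ring\<^esub> h \<in> Idl\<^bsub>ps_ring\<^esub> (set (take 1 [f, g]))
        \<longrightarrow> h \<in> Idl\<^bsub>ps_ring\<^esub> (set (take 1 [f, g]))"
      using reg unfolding regular_sequence_def by (metis One_nat_def Suc_1 length_Cons lessI list.size(3))
    then show ?thesis using that by (simp add: ps_ring_def genideal_ring_of_type_1)
  qed
  obtain \<phi> \<psi> where auto: "ps_auto \<phi> \<psi>" and f200: "cf (\<phi> f) (2, 0, 0) \<noteq> 0"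
    using ps_auto_quadric[OF f2 f3] by blast
  have \<phi>: "ps_endo \<phi>" and \<psi>: "ps_endo \<psi>" and inv: "\<psi> (\<phi> h) = h" "\<phi> (\<psi> h) = h" for h
    using auto by (auto simp: ps_auto_def)
  note hom = ps_endoD(1,2)[OF \<phi>] ps_endoD(1,2)[OF \<psi>] ps_endo_simps(4)[OF \<phi>] ps_endo_simps(4)[OF \<psi>] inv
  define F where "F = \<phi> f"
  have F: "F \<in> ps_ge 2" "cf F (2, 0, 0) \<noteq> 0" using f200 f2 by (simp_all add: F_def ps_endoD(4)[OF \<phi>])
  obtain q where q: "\<phi> g - q * F \<in> xdeg_less 2" using division_f[OF F] by blast
  \<comment> \<open>Replacing the second generator by its remainder leaves the ideal unchanged and
    makes the generator reduced.\<close>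
  define G where "G = \<phi> g - q * F"
  have img: "\<phi> ` I = pideal F G"
  proof
    show "\<phi> ` I \<subseteq> pideal F G"
    proof (rule image_subsetI)
      fix h assume "h \<in> I"
      then obtain u w where "h = u * g + w * f" unfolding I_eq pideal_def by blast
      then have "\<phi> h = \<phi> u * G + (\<phi> u * q + \<phi> w) * F"
        by (simp add: hom F_def G_def algebra_simps)
      then show "\<phi> h \<in> pideal F G" by (simp add: pidealI)
    qed
    show "pideal F G \<subseteq> \<phi> ` I"
    proof
      fix h assume "h \<in> pideal F G"
      then obtain u w where "h = u * G + w * F" unfolding pideal_def by blast
      then have "h = \<phi> (\<psi> u * g + \<psi> (w - u * q) * f)"
        by (simp add: hom F_def G_def algebra_simps)
      then show "h \<in> \<phi> ` I" unfolding I_eq by (simp add: pidealI)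
    qed
  qed
  have "G + q * F \<in> ps_ge b" using ps_endoD(4)[OF \<phi> gb] by (simp add: G_def)
  then have G1: "G \<in> ps_ge b" by (rule ps_ge_no_cancel[OF F q[folded G_def]])
  \<comment> \<open>A larger order of \<open>G\<close> would make \<open>g\<close> congruent to a
    multiple of \<open>f\<close> through degree \<open>b\<close>, against the condition on the
    initial forms.\<close>
  have G2: "G \<notin> ps_ge (Suc b)"
  proof
    assume "G \<in> ps_ge (Suc b)"
    then have "\<psi> G \<in> ps_ge (Suc b)" by (rule ps_endoD(4)[OF \<psi>])
    then have "g - \<psi> q * f \<in> ps_ge (Suc (ps_order g))" by (simp add: G_def F_def hom og)
    with initial_form_in_ideal[OF f0 _ g0] init of og assms(1) show False by auto
  qed
  have G0: "G \<noteq> 0" using G2 by auto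
  \<comment> \<open>Regularity is unaffected by subtracting a multiple of \<open>F\<close>, and it
    is transported back to \<open>f\<close>, \<open>g\<close> along \<open>\<psi>\<close>.\<close>
  have nzd': "h \<in> range (\<lambda>u. u * F)" if Gh: "G * h \<in> range (\<lambda>u. u * F)" for h
  proof -
    obtain u where "G * h = u * F" using Gh by blast
    then have "\<phi> g * h = (u + q * h) * F" by (simp add: G_def algebra_simps)
    then have "\<psi> (\<phi> g * h) = \<psi> ((u + q * h) * F)" by simp
    then have "g * \<psi> h = \<psi> (u + q * h) * f" by (simp only: hom F_def)
    then have "\<psi> h \<in> range (\<lambda>u. u * f)" by (intro nzd[OF range_eqI])
    then obtain w where "\<psi> h = w * f" by blast
    then have "\<phi> (\<psi> h) = \<phi> (w * f)" by simp
    then have "h = \<phi> w * F" by (simp only: hom F_def)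
    then show ?thesis by blast
  qed
  interpret staircase "lead_exps F G" b
  proof
    show "fst m < 2" if "m \<in> lead_exps F G" for m using that by (rule lead_exps_xdeg_less)
    show "(0, i, k) + m \<in> lead_exps F G" if "m \<in> lead_exps F G" for m i k using that refl by (rule lead_exps_shift_yz)
    show "(1, i, k) \<in> lead_exps F G" if "(0, i, k) \<in> lead_exps F G" for i k using that by (rule lead_exps_shift_x[OF F])
    show "b \<le> tdeg m" if "m \<in> lead_exps F G" for m
      using that by (rule lead_exps_low_degree(1)[OF F G1 G2 q[folded G_def]])
    show "\<exists>m. {m \<in> lead_exps F G. tdeg m = b} = {m}" by (rule lead_exps_low_degree(2)[OF F G1 G2 q[folded G_def]])
    show "\<exists>i<3. \<exists>m\<in>lead_exps F G. e i = (0, 0, 1) + m"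
      if "\<And>i. i < 3 \<Longrightarrow> e i \<in> lead_exps F G" "inj_on e {..<3}" "\<And>i. i < 3 \<Longrightarrow> tdeg (e i) = j" for e :: "nat \<Rightarrow> expo" and j
      by (rule lead_exps_z_generation[OF F that])
    show "\<exists>i k. (0, i, k) \<in> lead_exps F G" by (rule lead_exps_pure[OF F q[folded G_def] G0 nzd'])
    show "2 \<le> b" by (rule assms(1))
  qed
  show ?thesis by (rule hilbert_staircase) (rule HF_eq_card_lead_exps[OF auto I I1 F img])
qed

end
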